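(* Let $f$ be an inner function. The following are equivalent: (a) $f$ is contractive, i.e. $\sup_{z\in\mathbb D}D_h(f)(z)<1$. (b) There is a constant $C>0$ such that $$C^{-1}\,\omega(f(z_I),E)\le\frac{m(f^{-1}(E)\cap I)}{m(I)}\le C\,\omega(f(z_I),E)$$ for every measurable set $E\subset\partial\mathbb D$ and every arc $I\subset\partial\mathbb D$.
   Context: $\mathbb D$ is the unit disc, $m$ normalized Lebesgue measure on $\partial\mathbb D$, $|I|=m(I)$, and for an arc $I$ with center $\xi_I$, $z_I=(1-|I|)\xi_I$. An inner function is a bounded analytic function on $\mathbb D$ whose radial limits have modulus $1$ at $m$-a.e. point of $\partial\mathbb D$; $f^{-1}(E)$ denotes $\{\xi\in\partial\mathbb D:\text{the radial limit }f(\xi)\text{ exists and lies in }E\}$. The harmonic measure is $\omega(z,E)=\int_E\frac{1-|z|^2}{|\xi-z|^2}\,dm(\xi)$. $D_h(f)(z)=\frac{(1-|z|^2)|f'(z)|}{1-|f(z)|^2}$. *)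

theory Defs
  imports "HOL-Analysis.Analysis"
begin

definition circle_measure :: "complex measure" where
  "circle_measure = completion (distr (uniform_measure lborel {0..<2*pi}) borel cis)"

definition has_radial_limit :: "(complex \<Rightarrow> complex) \<Rightarrow> complex \<Rightarrow> complex \<Rightarrow> bool" where
  "has_radial_limit f \<xi> L \<longleftrightarrow> ((\<lambda>r::real. f (complex_of_real r * \<xi>)) \<longlongrightarrow> L) (at_left 1)"

definition inner_function :: "(complex \<Rightarrow> complex) \<Rightarrow> bool" where
  "inner_function f \<longleftrightarrow> f holomorphic_on ball 0 1 \<and> bounded (f ` ball 0 1) \<and>
     (AE \<xi> in circle_measure. \<xi> \<in> sphere 0 1 \<longrightarrow> (\<exists>L. has_radial_limit f \<xi> L \<and> norm L = 1))"

definition inner_preimage :: "(complex \<Rightarrow> complex) \<Rightarrow> complex set \<Rightarrow> complex set" where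
  "inner_preimage f E = {\<xi> \<in> sphere 0 1. \<exists>L. has_radial_limit f \<xi> L \<and> L \<in> E}"

definition harm_measure :: "complex \<Rightarrow> complex set \<Rightarrow> real" where
  "harm_measure z E = (LINT \<xi>:E|circle_measure. (1 - (norm z)\<^sup>2) / (norm (\<xi> - z))\<^sup>2)"

definition hyp_deriv :: "(complex \<Rightarrow> complex) \<Rightarrow> complex \<Rightarrow> real" where
  "hyp_deriv f z = (1 - (norm z)\<^sup>2) * norm (deriv f z) / (1 - (norm (f z))\<^sup>2)"

text \<open>The arc I = cis ` [a, a+l] (0 < l <= 2 pi), its centre, and the point z_I.\<close>
definition arc :: "real \<Rightarrow> real \<Rightarrow> complex set" where
  "arc a l = cis ` {a..a+l}"

definition arc_center :: "real \<Rightarrow> real \<Rightarrow> complex" where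
  "arc_center a l = cis (a + l/2)"

definition arc_point :: "real \<Rightarrow> real \<Rightarrow> complex" where
  "arc_point a l = complex_of_real (1 - measure circle_measure (arc a l)) * arc_center a l"

end

theory Submission
  imports Defs "HOL-Complex_Analysis.Cauchy_Integral_Formula"
begin

text \<open>
  Write \<open>P\<^sub>z\<close> for the Poisson kernel and \<open>T = f\<^sup>-\<^sup>1(E)\<close>. Cauchy's formula for the powers of \<open>f\<close> shows that \<open>f\<close>
  pushes \<open>P\<^sub>z dm\<close> forward to \<open>P\<^bsub>f z\<^esub> dm\<close>, that is \<open>\<omega>(z, T) = \<omega>(f z, E)\<close>. The upper bound in (b) therefore
  holds for every inner function.

  For the lower bound move from \<open>z\<^sub>I\<close> to the point \<open>w\<close> of the same radius at depth \<open>\<epsilon> |I|\<close>. By Harnack's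
  inequality and contractivity \<open>\<omega>(w, T) = \<omega>(f w, E)\<close> loses only a factor of order \<open>\<epsilon>\<^sup>q\<close> with \<open>q < 1\<close>, whereas the
  part of \<open>T\<close> outside \<open>I\<close> contributes at most a factor of order \<open>\<epsilon>\<close>; for small \<open>\<epsilon>\<close> a fixed proportion of the
  harmonic measure has to come from \<open>T \<inter> I\<close>.

  Conversely, with \<open>\<phi>\<^sub>a\<close> the disc automorphism vanishing at \<open>a\<close>, a suitable unimodular \<open>\<kappa>\<close> gives
  \<open>\<integral> |\<phi>\<^bsub>f z\<^esub> \<circ> f - \<kappa> \<phi>\<^sub>z|\<^sup>2 P\<^sub>z dm = 2 - 2 D\<^sub>h(f)(z)\<close>. If \<open>D\<^sub>h(f)(z)\<close> is close to 1, then \<open>f\<close> nearly acts as an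
  automorphism on the boundary as seen from \<open>z\<close>, and a set \<open>E\<close> separated by it from the image of an arc
  violates the lower bound in (b).
\<close>

section \<open>Arcs and normalized arc length\<close>

text \<open>The measure before completion. Integrals and distributions are computed here with Borel
  functions and then carried over to \<open>circle_measure\<close>, whose completion admits all
  Lebesgue measurable sets.\<close>

definition circle_borel :: "complex measure" where
  "circle_borel = distr (uniform_measure lborel {0..<2*pi}) borel cis"

lemma circle_measure_eq_completion: "circle_measure = completion circle_borel"
  by (simp add: circle_measure_def circle_borel_def)

lemma borel_measurable_cis [measurable]: "cis \<in> borel_measurable borel"
  by (intro borel_measurable_continuous_onI continuous_intros)

lemma sets_circle_borel [simp, measurable_cong]: "sets circle_borel = sets borel"
  by (simp add: circle_borel_def)

lemma space_circle_borel [simp]: "space circle_borel = UNIV"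
  by (simp add: circle_borel_def)

lemma borel_in_sets_circle_measure: "E \<in> sets borel \<Longrightarrow> E \<in> sets circle_measure"
  by (simp add: circle_measure_eq_completion)

lemma emeasure_circle_borel:
  assumes [measurable]: "E \<in> sets borel"
  shows "emeasure circle_borel E = emeasure lborel ({0..<2*pi} \<inter> cis -` E) / ennreal (2*pi)"
proof -
  have [measurable]: "cis -` E \<in> sets borel"
    using measurable_sets[OF borel_measurable_cis, of E] by simp
  show ?thesis
    unfolding circle_borel_def by (subst emeasure_distr) auto
qed

lemma finite_measure_circle_borel: "finite_measure circle_borel"
proof
  show "emeasure circle_borel (space circle_borel) \<noteq> \<infinity>"
    by (simp add: emeasure_circle_borel divide_ennreal)
qed

interpretation circle_borel: finite_measure circle_borel
  by (rule finite_measure_circle_borel)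

lemma finite_measure_circle_measure: "finite_measure circle_measure"
  using circle_borel.emeasure_finite[of UNIV]
  by (intro finite_measureI) (simp add: circle_measure_eq_completion)

interpretation circle_measure: finite_measure circle_measure
  by (rule finite_measure_circle_measure)

lemma AE_circle_borel_sphere: "AE \<xi> in circle_borel. \<xi> \<in> sphere 0 1"
  unfolding circle_borel_def by (subst AE_distr_iff) auto

lemma AE_circle_measure_sphere: "AE \<xi> in circle_measure. \<xi> \<in> sphere 0 1"
  unfolding circle_measure_eq_completion by (rule AE_completion[OF AE_circle_borel_sphere])

lemma integral_circle_borel:
  fixes h :: "complex \<Rightarrow> 'b::{banach, second_countable_topology}"
  assumes [measurable]: "h \<in> borel_measurable borel"
  shows "integral\<^sup>L circle_borel h = (1/(2*pi)) *\<^sub>R (LINT t:{0..<2*pi}|lborel. h (cis t))"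
proof -
  have "uniform_measure lborel {0..<2*pi} = density lborel (\<lambda>x. ennreal (indicator {0..<2*pi} x / (2*pi)))"
    unfolding uniform_measure_def
    by (intro density_cong) (auto simp: indicator_def divide_ennreal simp flip: ennreal_1)
  then show ?thesis
    unfolding circle_borel_def set_lebesgue_integral_def
    by (subst integral_distr) (auto simp: integral_density simp flip: integral_scaleR_right)
qed

text \<open>Passes to the gauge integral over the closed interval, the form in which
  \<open>Cauchy_circle_average\<close> evaluates contour integrals; the added endpoint is a null
  set.\<close>

lemma integral_circle_borel_continuous:
  fixes h :: "complex \<Rightarrow> 'b::euclidean_space"
  assumes [measurable]: "h \<in> borel_measurable borel" and cont: "continuous_on UNIV (\<lambda>t. h (cis t))"
  shows "integral\<^sup>L circle_borel h = (1/(2*pi)) *\<^sub>R integral {0..2*pi} (\<lambda>t. h (cis t))"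
proof -
  have "(LINT t:{0..<2*pi}|lborel. h (cis t)) = (LINT t:{0..2*pi}|lborel. h (cis t))"
    unfolding set_lebesgue_integral_def
  proof (rule integral_cong_AE)
    have "AE t in lborel. t \<noteq> 2*pi"
      by (rule AE_lborel_singleton)
    then show "AE t in lborel. indicat_real {0..<2*pi} t *\<^sub>R h (cis t) = indicat_real {0..2*pi} t *\<^sub>R h (cis t)"
      by eventually_elim (auto simp: indicator_def)
  qed auto
  also have "\<dots> = integral {0..2*pi} (\<lambda>t. h (cis t))"
    using borel_integrable_compact[of "{0..2*pi}" "\<lambda>t. h (cis t)"] continuous_on_subset[OF cont, of "{0..2*pi}"]
    by (intro set_borel_integral_eq_integral) (auto simp: set_integrable_def)
  finally show ?thesis
    by (simp add: integral_circle_borel)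
qed

lemma cis_eq_iff_2pi: "cis s = cis t \<longleftrightarrow> (\<exists>k::int. s = t + 2*pi* of_int k)"
proof -
  have "cis s = cis t \<longleftrightarrow> (\<exists>k::int. \<i> * of_real s = \<i> * of_real (t + 2*pi* of_int k))"
    unfolding cis_conv_exp exp_eq by (auto simp: algebra_simps)
  then show ?thesis
    by (simp only: mult_cancel_left of_real_eq_iff complex_i_not_zero simp_thms)
qed

lemma arc_shift: "arc (a + 2*pi* of_int k) l = arc a l"
proof -
  have "cis ` {a + 2*pi* of_int k..a + 2*pi* of_int k + l} = cis ` (\<lambda>t. t + 2*pi* of_int k) ` {a..a+l}"
    by (simp add: image_add_atLeastAtMost' add_ac)
  also have "\<dots> = cis ` {a..a+l}"
    unfolding image_image by (intro image_cong refl) (metis cis_eq_iff_2pi)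
  finally show ?thesis by (simp add: arc_def)
qed

lemma compact_arc: "compact (arc a l)"
  unfolding arc_def by (intro compact_continuous_image continuous_intros compact_Icc)

lemma arc_borel [measurable]: "arc a l \<in> sets borel"
  by (intro borel_closed compact_imp_closed compact_arc)

lemma measure_arc:
  assumes "0 < l" "l \<le> 2*pi"
  shows "measure circle_measure (arc a l) = l / (2*pi)"
proof -
  \<comment> \<open>Shifting by whole turns puts the starting angle into \<open>{0..<2*pi}\<close>,
    so the arc reaches the angle \<open>2*pi\<close> at most once.\<close>
  define k where "k = \<lfloor>a / (2*pi)\<rfloor>"
  define b where "b = a - 2*pi* of_int k"
  have b: "0 \<le> b" "b < 2*pi" "a = b + 2*pi* of_int k"
    using floor_divide_lower[of "2*pi" a] floor_divide_upper[of "2*pi" a]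
    by (auto simp: b_def k_def algebra_simps)
  have arc: "arc a l = arc b l"
    by (simp add: b(3) arc_shift)
  \<comment> \<open>The last set is the part of the arc wrapped around past \<open>2*pi\<close>. It
    is empty if \<open>b + l < 2*pi\<close>; otherwise the middle set is empty.\<close>
  have eq: "{0..<2*pi} \<inter> cis -` arc b l = {b..<min (b+l) (2*pi)} \<union> ({b+l}\<inter>{..<2*pi}) \<union> {0..b+l-2*pi}" (is "?L = ?R")
  proof (intro equalityI subsetI)
    fix t assume "t \<in> ?L"
    then obtain s where s: "0 \<le> t" "t < 2*pi" "cis t = cis s" "b \<le> s" "s \<le> b+l"
      by (auto simp: arc_def)
    then obtain j :: int where j: "s = t + 2*pi* of_int j"
      by (metis cis_eq_iff_2pi)
    have "2*pi*(-1) < 2*pi* of_int j" "2*pi* of_int j < 2*pi*2"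
      using s(1,2,4,5) unfolding j using b(1,2) assms by linarith+
    then have "(-1::real) < of_int j" "of_int j < (2::real)"
      by (metis mult_less_cancel_left_pos pi_gt_zero zero_less_mult_iff zero_less_numeral)+
    then have "j > -1" "j < 2"
      by linarith+
    then consider "j = 0" | "j = 1" by force
    then show "t \<in> ?R"
      using s j b assms by cases auto
  next
    fix t assume t: "t \<in> ?R"
    show "t \<in> ?L"
    proof (cases "t \<in> {0..b+l-2*pi}")
      case True
      then have "cis t = cis (t + 2*pi)" "t + 2*pi \<in> {b..b+l}"
        using b by (auto simp flip: cis_mult)
      then show ?thesis using True b assms by (auto simp: arc_def)
    next
      case False
      then show ?thesis using t b assms by (auto simp: arc_def)
    qed
  qed
  have "emeasure lborel ?R = ennreal l"
  proof (cases "b + l < 2*pi")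
    case True
    then have "?R = {b..b+l}" using assms b by auto
    then show ?thesis using assms by simp
  next
    case False
    then have R: "?R = {b..<2*pi} \<union> {0..b+l-2*pi}" by auto
    \<comment> \<open>For \<open>l = 2*pi\<close> the two pieces share the point \<open>b\<close>.
      Dropping one endpoint, a null set, makes them disjoint.\<close>
    have "AE t in lborel. (t \<in> ?R) = (t \<in> {b..<2*pi} \<union> {0..<b+l-2*pi})"
      using AE_lborel_singleton[of "b+l-2*pi"] unfolding R by eventually_elim auto
    then have "emeasure lborel ?R = emeasure lborel ({b..<2*pi} \<union> {0..<b+l-2*pi})"
      by (intro emeasure_eq_AE) auto
    also have "\<dots> = emeasure lborel {b..<2*pi} + emeasure lborel {0..<b+l-2*pi}"
      using assms by (intro plus_emeasure[symmetric]) auto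
    also have "\<dots> = ennreal l"
      using False b by (simp flip: ennreal_plus)
    finally show ?thesis .
  qed
  then have "emeasure circle_borel (arc a l) = ennreal (l/(2*pi))"
    using assms by (simp add: emeasure_circle_borel arc eq divide_ennreal)
  then show ?thesis
    using assms by (simp add: circle_measure_eq_completion measure_def)
qed

section \<open>Chord length against arc length\<close>

lemma norm_cis_diff: "norm (cis s - cis t) = 2 * \<bar>sin ((s - t)/2)\<bar>"
proof -
  have "(norm (cis s - cis t))\<^sup>2 = 2 - 2 * cos (s - t)"
    unfolding cmod_power2 cos_diff using sin_cos_squared_add[of s] sin_cos_squared_add[of t]
    by (simp add: power2_diff algebra_simps)
  also have "cos (s - t) = 1 - 2 * (sin ((s-t)/2))\<^sup>2"
    using cos_double_sin[of "(s-t)/2"] by (simp only: mult_2 field_sum_of_halves)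
  finally have "(norm (cis s - cis t))\<^sup>2 = (2 * \<bar>sin ((s - t)/2)\<bar>)\<^sup>2"
    by (simp add: power_mult_distrib)
  then show ?thesis
    by (rule power2_eq_imp_eq) auto
qed

lemma norm_cis_diff_le: "norm (cis s - cis t) \<le> \<bar>s - t\<bar>"
  using abs_sin_x_le_abs_x[of "(s-t)/2"] by (simp add: norm_cis_diff)

text \<open>Jordan's inequality: the sine is concave, so it lies above its chord from 0 to
  \<open>pi/2\<close>.\<close>

lemma sin_ge_linear:
  assumes "0 \<le> x" "x \<le> pi/2"
  shows "sin x \<ge> 2 * x / pi"
proof -
  have "concave_on {0..pi} sin"
    by (rule f''_le0_imp_concave[where f' = cos and f'' = "\<lambda>x. - sin x"])
       (auto intro!: derivative_eq_intros sin_ge_zero)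
  from concave_onD[OF this, of "2*x/pi" 0 "pi/2"] show ?thesis
    using assms by (auto simp: field_simps)
qed

lemma norm_cis_diff_ge:
  assumes "\<bar>s - t\<bar> \<le> pi"
  shows "norm (cis s - cis t) \<ge> 2 * \<bar>s - t\<bar> / pi"
proof -
  have "sin (\<bar>s - t\<bar>/2) \<ge> 2 * (\<bar>s - t\<bar>/2) / pi"
    using assms by (intro sin_ge_linear) auto
  moreover have "\<bar>sin ((s - t)/2)\<bar> = \<bar>sin (\<bar>s - t\<bar>/2)\<bar>"
    using sin_minus[of "(s-t)/2"] by (cases "s \<ge> t") (simp_all add: minus_divide_left)
  ultimately show ?thesis by (simp add: norm_cis_diff)
qed

lemma dist_arc_center_le:
  assumes "\<xi> \<in> arc a l"
  shows "norm (\<xi> - arc_center a l) \<le> l/2"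
proof -
  obtain t where "\<xi> = cis t" "a \<le> t" "t \<le> a+l"
    using assms by (auto simp: arc_def)
  then show ?thesis
    unfolding arc_center_def using norm_cis_diff_le[of t "a+l/2"] by auto
qed

text \<open>Seen from the centre, a point off the arc has angle more than \<open>l/2\<close>, and a
  chord is at least \<open>2/pi\<close> times its angle. In terms of the normalized length
  \<open>m = l / (2*pi)\<close> the bound is \<open>2*m\<close>, the distance that
  \<open>poisson_kernel_le_far\<close> asks for.\<close>

lemma dist_arc_center_ge:
  assumes "\<xi> \<in> sphere 0 1" "\<xi> \<notin> arc a l"
  shows "norm (\<xi> - arc_center a l) \<ge> l/pi"
proof -
  define c where "c = a + l/2"
  define s where "s = Arg (\<xi> / cis c)"
  have s: "-pi < s" "s \<le> pi" unfolding s_def by (auto simp: Arg_bounded)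
  have "cis s = \<xi> / cis c"
    unfolding s_def using assms(1) by (subst cis_Arg) (auto simp: sgn_div_norm norm_divide)
  then have \<xi>: "\<xi> = cis (c + s)"
    by (simp flip: cis_mult)
  have "c + s \<notin> {a..a+l}"
    using assms(2) unfolding arc_def \<xi> by blast
  then have "\<not> \<bar>s\<bar> \<le> l/2"
    unfolding c_def by (auto simp: abs_le_iff)
  then have "l / pi \<le> 2 * \<bar>s\<bar> / pi"
    by (intro divide_right_mono) auto
  also have "\<dots> \<le> norm (\<xi> - arc_center a l)"
    using norm_cis_diff_ge[of "c+s" c] s unfolding arc_center_def \<xi> c_def by auto
  finally show ?thesis .
qed

section \<open>Cauchy and Poisson formulas for boundary values\<close>

text \<open>A fixed sequence of radii allows dominated convergence and makes boundary functions
  measurable as limits of sequences. The shift by 2 keeps the radius positive at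
  \<open>n = 0\<close>.\<close>

definition radius :: "nat \<Rightarrow> real" where
  "radius n = 1 - 1 / (real n + 2)"

lemma radius_bounds: "0 < radius n" "radius n < 1"
  by (auto simp: radius_def field_simps)

lemma radius_tendsto: "radius \<longlonglongrightarrow> 1"
proof -
  have "(\<lambda>n. 1 - 1 / real (n + 2)) \<longlonglongrightarrow> 1 - 0"
    by (intro tendsto_intros LIMSEQ_ignore_initial_segment[OF lim_1_over_n])
  then show ?thesis by (simp add: radius_def[abs_def] add.commute)
qed

lemma radius_at_left: "filterlim radius (at_left 1) sequentially"
  using radius_tendsto radius_bounds by (auto simp: filterlim_at less_imp_neq)

text \<open>Convergence is asked only along \<open>radius\<close>. The notion is stable under powers
  and disc automorphisms, which is how \<open>f\<close> enters the integral formulas below.\<close>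

definition has_boundary_values :: "(complex \<Rightarrow> complex) \<Rightarrow> (complex \<Rightarrow> complex) \<Rightarrow> bool" where
  "has_boundary_values g h \<longleftrightarrow> g holomorphic_on ball 0 1 \<and> bounded (g ` ball 0 1) \<and>
     h \<in> borel_measurable borel \<and>
     (AE \<xi> in circle_borel. (\<lambda>n. g (of_real (radius n) * \<xi>)) \<longlonglongrightarrow> h \<xi>)"

text \<open>Outside the disc \<open>g\<close> is arbitrary and may fail to be measurable, hence the
  cut-off.\<close>

lemma borel_measurable_extend_zero:
  fixes g :: "complex \<Rightarrow> complex"
  assumes "continuous_on (ball 0 1) g"
  shows "(\<lambda>w. if w \<in> ball 0 1 then g w else 0) \<in> borel_measurable borel"
proof -
  have "(\<lambda>w. indicator (ball 0 1) w *\<^sub>R g w) \<in> borel_measurable borel"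
    by (intro borel_measurable_continuous_on_indicator assms) auto
  also have "(\<lambda>w. indicator (ball 0 1) w *\<^sub>R g w) = (\<lambda>w. if w \<in> ball 0 1 then g w else 0)"
    by (auto simp: fun_eq_iff)
  finally show ?thesis .
qed

text \<open>On the circle \<open>d\<zeta> = \<i> \<zeta> dt\<close>. This accounts for the extra
  factor \<open>r * cis t\<close>, and dividing by \<open>\<i>\<close> leaves an average over the
  angle.\<close>

lemma Cauchy_circle_average:
  fixes g :: "complex \<Rightarrow> complex"
  assumes holo: "g holomorphic_on ball 0 1" and r: "0 < r" "r < 1" and z: "norm z < r"
  shows "integral {0..2*pi} (\<lambda>t. g (r * cis t) * (r * cis t) / (r * cis t - z) ^ Suc k)
          = 2 * pi * (deriv ^^ k) g z / fact k"
proof -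
  have cball: "cball 0 r \<subseteq> ball (0::complex) 1" "ball 0 r \<subseteq> ball (0::complex) 1" using r by auto
  have "((\<lambda>u. g u / (u-z) ^ (Suc k)) has_contour_integral ((2 * pi * \<i>) / (fact k) * (deriv ^^ k) g z)) (circlepath 0 r)"
    using z cball holo
    by (intro Cauchy_has_contour_integral_higher_derivative_circlepath)
       (auto intro: holomorphic_on_subset holomorphic_on_imp_continuous_on)
  then have "((\<lambda>t. g (r * cis t) / (r * cis t - z) ^ Suc k * r * \<i> * cis t) has_integral
      ((2 * pi * \<i>) / (fact k) * (deriv ^^ k) g z)) {0..2*pi}"
    unfolding circlepath_def by (subst (asm) has_contour_integral_part_circlepath_iff) (simp_all add: r)
  then have "((\<lambda>t. (-\<i>) * (g (r * cis t) / (r * cis t - z) ^ Suc k * r * \<i> * cis t)) has_integral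
      (-\<i>) * ((2 * pi * \<i>) / (fact k) * (deriv ^^ k) g z)) {0..2*pi}"
    by (rule has_integral_mult_right)
  then show ?thesis
    by (intro integral_unique) (simp add: mult_ac)
qed

text \<open>The formula holds on each circle of radius \<open>radius n\<close> around
  \<open>z\<close>'s disc of modulus \<open>norm z\<close>; dominated convergence lets the radius
  tend to 1.\<close>

lemma Cauchy_boundary_values:
  assumes g: "has_boundary_values g h" and z: "norm z < 1"
  shows "integral\<^sup>L circle_borel (\<lambda>\<xi>. h \<xi> * \<xi> / (\<xi> - z) ^ Suc k) = (deriv ^^ k) g z / fact k"
proof -
  have holo: "g holomorphic_on ball 0 1" and h [measurable]: "h \<in> borel_measurable borel"
    and lim: "AE \<xi> in circle_borel. (\<lambda>n. g (of_real (radius n) * \<xi>)) \<longlonglongrightarrow> h \<xi>"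
    using g by (auto simp: has_boundary_values_def)
  obtain B where B: "\<And>w. w \<in> ball 0 1 \<Longrightarrow> norm (g w) \<le> B" and "0 < B"
    using g unfolding has_boundary_values_def bounded_pos by blast
  define g0 where "g0 w = (if w \<in> ball 0 1 then g w else 0)" for w
  have g0 [measurable]: "g0 \<in> borel_measurable borel"
    using borel_measurable_extend_zero[OF holomorphic_on_imp_continuous_on[OF holo]] by (simp add: g0_def[abs_def])
  \<comment> \<open>Halfway between \<open>norm z\<close> and 1. Starting the sequence at
    \<open>N\<close> keeps all circles outside radius \<rho>, so the Cauchy kernels share one
    bound.\<close>
  define \<rho> where "\<rho> = (1 + norm z) / 2"
  have \<rho>: "norm z < \<rho>" "\<rho> < 1" using z by (auto simp: \<rho>_def)
  obtain N where N: "\<And>n. n \<ge> N \<Longrightarrow> radius n > \<rho>"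
    using order_tendstoD(1)[OF radius_tendsto \<rho>(2)] by (auto simp: eventually_sequentially)
  define s where "s n \<xi> = g0 (radius (n+N) * \<xi>) * (radius (n+N) * \<xi>) / (radius (n+N) * \<xi> - z) ^ Suc k" for n and \<xi> :: complex
  have [measurable]: "s n \<in> borel_measurable borel" for n
    unfolding s_def by measurable
  have int_s: "integral\<^sup>L circle_borel (s n) = (deriv ^^ k) g z / fact k" for n
  proof -
    let ?r = "radius (n+N)"
    have r: "0 < ?r" "?r < 1" "norm z < ?r" using radius_bounds[of "n+N"] N[of "n+N"] \<rho> by auto
    have sc: "s n (cis t) = g (?r * cis t) * (?r * cis t) / (?r * cis t - z) ^ Suc k" for t
      using r by (auto simp: s_def g0_def norm_mult)
    have ne: "?r * cis t \<noteq> z" for t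
    proof -
      have "norm (?r * cis t) \<noteq> norm z" using r by (simp add: norm_mult)
      then show ?thesis by metis
    qed
    have "continuous_on UNIV (\<lambda>t. s n (cis t))"
      unfolding sc using r ne
      by (intro continuous_intros continuous_on_compose2[OF holomorphic_on_imp_continuous_on[OF holo]])
         (auto simp: norm_mult)
    then have "integral\<^sup>L circle_borel (s n) = (1/(2*pi)) *\<^sub>R integral {0..2*pi} (\<lambda>t. s n (cis t))"
      by (intro integral_circle_borel_continuous) auto
    also have "integral {0..2*pi} (\<lambda>t. s n (cis t)) = 2 * pi * (deriv ^^ k) g z / fact k"
      unfolding sc by (rule Cauchy_circle_average[OF holo r])
    finally show ?thesis by (simp add: scaleR_conv_of_real)
  qed
  have "(\<lambda>n. integral\<^sup>L circle_borel (s n)) \<longlonglongrightarrow> integral\<^sup>L circle_borel (\<lambda>\<xi>. h \<xi> * \<xi> / (\<xi> - z) ^ Suc k)"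
  proof (rule integral_dominated_convergence[where w = "\<lambda>_. B / (\<rho> - norm z) ^ Suc k"])
    show "AE \<xi> in circle_borel. (\<lambda>n. s n \<xi>) \<longlonglongrightarrow> h \<xi> * \<xi> / (\<xi> - z) ^ Suc k"
      using lim AE_circle_borel_sphere
    proof eventually_elim
      case (elim \<xi>)
      have eq: "s n \<xi> = g (radius (n+N) * \<xi>) * (radius (n+N) * \<xi>) / (radius (n+N) * \<xi> - z) ^ Suc k" for n
        using elim(2) radius_bounds[of "n+N"] by (auto simp: s_def g0_def norm_mult)
      have ne: "\<xi> \<noteq> z" using elim(2) z by auto
      have r: "(\<lambda>n. complex_of_real (radius (n+N))) \<longlonglongrightarrow> 1"
        using tendsto_of_real[OF LIMSEQ_ignore_initial_segment[OF radius_tendsto, of N], where 'a=complex] by simp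
      have "(\<lambda>n. s n \<xi>) \<longlonglongrightarrow> h \<xi> * (1 * \<xi>) / (1 * \<xi> - z) ^ Suc k"
        unfolding eq using ne
        by (intro tendsto_intros r LIMSEQ_ignore_initial_segment[OF elim(1)]) auto
      then show ?case by simp
    qed
    show "AE \<xi> in circle_borel. norm (s n \<xi>) \<le> B / (\<rho> - norm z) ^ Suc k" for n
      using AE_circle_borel_sphere
    proof eventually_elim
      case (elim \<xi>)
      let ?r = "radius (n+N)"
      have r: "0 < ?r" "?r < 1" "\<rho> < ?r" using radius_bounds[of "n+N"] N[of "n+N"] \<rho> by auto
      have "norm (of_real ?r * \<xi>) = ?r" using elim r by (simp add: norm_mult)
      then have d: "\<rho> - norm z \<le> norm (of_real ?r * \<xi> - z)" and b: "of_real ?r * \<xi> \<in> ball 0 1"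
        using norm_triangle_ineq2[of "of_real ?r * \<xi>" z] r by auto
      have "norm (s n \<xi>) \<le> (B * 1) / (\<rho> - norm z) ^ Suc k"
        unfolding s_def norm_divide norm_power norm_mult using d b B[OF b] r \<rho> elim \<open>0 < B\<close>
        by (intro frac_le mult_mono power_mono) (auto simp: g0_def norm_mult)
      then show ?case by simp
    qed
  qed auto
  then show ?thesis
    unfolding int_s by (simp add: LIMSEQ_const_iff)
qed

section \<open>The Poisson kernel and the Poisson formula\<close>

definition poisson_kernel :: "complex \<Rightarrow> complex \<Rightarrow> real" where
  "poisson_kernel z \<xi> = (1 - (norm z)\<^sup>2) / (norm (\<xi> - z))\<^sup>2"

lemma borel_measurable_poisson_kernel [measurable]: "poisson_kernel z \<in> borel_measurable borel"
  unfolding poisson_kernel_def[abs_def] by measurable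

lemma norm_lt_1_imp_sq: "norm (z::complex) < 1 \<Longrightarrow> 0 < 1 - (norm z)\<^sup>2"
  by (simp add: power_less_one_iff abs_square_less_1)

lemma poisson_kernel_pos: "norm z < 1 \<Longrightarrow> \<xi> \<in> sphere 0 1 \<Longrightarrow> 0 < poisson_kernel z \<xi>"
  unfolding poisson_kernel_def by (intro divide_pos_pos norm_lt_1_imp_sq) auto

lemma poisson_kernel_nonneg: "norm z < 1 \<Longrightarrow> 0 \<le> poisson_kernel z \<xi>"
  unfolding poisson_kernel_def by (intro divide_nonneg_nonneg less_imp_le[OF norm_lt_1_imp_sq]) auto

lemma poisson_kernel_le:
  assumes z: "norm z < 1" and \<xi>: "\<xi> \<in> sphere 0 1"
  shows "poisson_kernel z \<xi> \<le> 2 / (1 - norm z)"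
proof -
  have d: "1 - norm z \<le> norm (\<xi> - z)"
    using norm_triangle_ineq2[of \<xi> z] \<xi> by simp
  have "poisson_kernel z \<xi> \<le> (1 - (norm z)\<^sup>2) / (1 - norm z)\<^sup>2"
    unfolding poisson_kernel_def using z d norm_lt_1_imp_sq[OF z] by (intro divide_left_mono power_mono mult_pos_pos) auto
  also have "\<dots> = (1 + norm z) / (1 - norm z)"
  proof -
    have "1 - (norm z)\<^sup>2 = (1 - norm z) * (1 + norm z)"
      by (simp add: power2_eq_square algebra_simps)
    then show ?thesis using z by (simp add: power2_eq_square)
  qed
  also have "\<dots> \<le> 2 / (1 - norm z)"
    using z by (intro divide_right_mono) auto
  finally show ?thesis .
qed

lemma sphere_cnj: "\<xi> \<in> sphere 0 1 \<Longrightarrow> \<xi> * cnj \<xi> = 1"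
  by (simp flip: complex_norm_square)

text \<open>On the circle the kernel splits into a factor holomorphic in \<xi> and the Cauchy kernel
  \<open>\<xi> / (\<xi> - z)\<close>. Poisson's formula for \<open>g\<close> thus becomes Cauchy's
  formula for \<open>g\<close> times that factor.\<close>

lemma poisson_kernel_complex:
  assumes \<xi>: "\<xi> \<in> sphere 0 1" and z: "norm z < 1"
  shows "complex_of_real (poisson_kernel z \<xi>) = (1 - of_real ((norm z)\<^sup>2)) / (1 - cnj z * \<xi>) * \<xi> / (\<xi> - z)"
proof -
  have ne: "\<xi> \<noteq> z" "\<xi> \<noteq> 0" using assms by auto
  have c: "cnj (\<xi> - z) * \<xi> = 1 - cnj z * \<xi>"
    using sphere_cnj[OF \<xi>] by (simp add: algebra_simps)
  have c0: "cnj (\<xi> - z) \<noteq> 0" using ne by simp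
  have "complex_of_real (poisson_kernel z \<xi>) = (1 - of_real ((norm z)\<^sup>2)) / ((\<xi> - z) * cnj (\<xi> - z))"
    by (simp add: poisson_kernel_def flip: complex_norm_square del: complex_cnj_diff)
  also have "\<dots> = (1 - of_real ((norm z)\<^sup>2)) / (cnj (\<xi> - z) * \<xi>) * \<xi> / (\<xi> - z)"
    using ne c0 by (simp del: complex_cnj_diff)
  finally show ?thesis
    unfolding c .
qed

lemma mobius_denom_ge: "norm w \<le> 1 \<Longrightarrow> 1 - norm a \<le> norm (1 - cnj a * w)"
proof -
  assume w: "norm w \<le> 1"
  have "norm (cnj a * w) \<le> norm a * 1"
    unfolding norm_mult using w by (intro mult_mono) auto
  then show ?thesis using norm_triangle_ineq2[of 1 "cnj a * w"] by simp
qed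

lemma mobius_denom_nz: "norm a < 1 \<Longrightarrow> norm w \<le> 1 \<Longrightarrow> 1 - cnj a * w \<noteq> 0"
  using mobius_denom_ge[of w a] by auto

lemma Poisson_boundary_values:
  assumes g: "has_boundary_values g h" and z: "norm z < 1"
  shows "integral\<^sup>L circle_borel (\<lambda>\<xi>. of_real (poisson_kernel z \<xi>) * h \<xi>) = g z"
proof -
  have holo: "g holomorphic_on ball 0 1" and h [measurable]: "h \<in> borel_measurable borel"
    and lim: "AE \<xi> in circle_borel. (\<lambda>n. g (of_real (radius n) * \<xi>)) \<longlonglongrightarrow> h \<xi>"
    using g by (auto simp: has_boundary_values_def)
  obtain B where B: "\<And>w. w \<in> ball 0 1 \<Longrightarrow> norm (g w) \<le> B" and "0 < B"
    using g unfolding has_boundary_values_def bounded_pos by blast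
  \<comment> \<open>The holomorphic factor of the Poisson kernel. It equals 1 at \<open>z\<close>,
    so Cauchy's formula for \<open>g * c\<close> returns \<open>g z\<close>.\<close>
  define c where "c w = (1 - of_real ((norm z)\<^sup>2)) / (1 - cnj z * w)" for w :: complex
  note c_ge = mobius_denom_ge[of _ z] and c_ne = mobius_denom_nz[OF z]
  have "has_boundary_values (\<lambda>w. g w * c w) (\<lambda>\<xi>. h \<xi> * c \<xi>)"
    unfolding has_boundary_values_def
  proof (intro conjI)
    show "(\<lambda>w. g w * c w) holomorphic_on ball 0 1"
      unfolding c_def using c_ne by (intro holomorphic_intros holo) auto
    have "norm (g w * c w) \<le> B * (norm (1 - complex_of_real ((norm z)\<^sup>2)) / (1 - norm z))" if "w \<in> ball 0 1" for w
      unfolding norm_mult c_def norm_divide using that z B[OF that] \<open>0 < B\<close> c_ge[of w]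
      by (intro mult_mono divide_left_mono mult_pos_pos) auto
    then show "bounded ((\<lambda>w. g w * c w) ` ball 0 1)"
      unfolding bounded_iff by blast
    show "(\<lambda>\<xi>. h \<xi> * c \<xi>) \<in> borel_measurable borel"
      unfolding c_def by measurable
    show "AE \<xi> in circle_borel. (\<lambda>n. g (radius n * \<xi>) * c (radius n * \<xi>)) \<longlonglongrightarrow> h \<xi> * c \<xi>"
      using lim AE_circle_borel_sphere
    proof eventually_elim
      case (elim \<xi>)
      have r: "(\<lambda>n. complex_of_real (radius n)) \<longlonglongrightarrow> 1"
        using tendsto_of_real[OF radius_tendsto, where 'a=complex] by simp
      have "(\<lambda>n. g (radius n * \<xi>) * c (radius n * \<xi>)) \<longlonglongrightarrow> h \<xi> * c (1 * \<xi>)"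
        unfolding c_def using elim c_ne[of \<xi>] by (intro tendsto_intros r) auto
      then show ?case by simp
    qed
  qed
  from Cauchy_boundary_values[OF this z, of 0]
  have "integral\<^sup>L circle_borel (\<lambda>\<xi>. h \<xi> * c \<xi> * \<xi> / (\<xi> - z)) = g z * c z"
    by simp
  also have "c z = 1"
    using c_ne[of z] z complex_norm_square[of z] by (simp add: c_def mult_ac)
  also have "integral\<^sup>L circle_borel (\<lambda>\<xi>. h \<xi> * c \<xi> * \<xi> / (\<xi> - z)) =
      integral\<^sup>L circle_borel (\<lambda>\<xi>. of_real (poisson_kernel z \<xi>) * h \<xi>)"
  proof (rule integral_cong_AE)
    show "AE \<xi> in circle_borel. h \<xi> * c \<xi> * \<xi> / (\<xi> - z) = of_real (poisson_kernel z \<xi>) * h \<xi>"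
      using AE_circle_borel_sphere
      by eventually_elim (simp add: poisson_kernel_complex z c_def)
  qed (auto simp: c_def)
  finally show ?thesis by simp
qed

lemma integrable_poisson_kernel_mult:
  fixes h :: "complex \<Rightarrow> 'b::{banach, second_countable_topology, real_normed_algebra}"
  assumes z: "norm z < 1" and [measurable]: "h \<in> borel_measurable borel"
    and h: "AE \<xi> in circle_borel. norm (h \<xi>) \<le> B"
  shows "integrable circle_borel (\<lambda>\<xi>. poisson_kernel z \<xi> *\<^sub>R h \<xi>)"
proof (rule circle_borel.integrable_const_bound[where B = "2 / (1 - norm z) * \<bar>B\<bar>"])
  show "AE \<xi> in circle_borel. norm (poisson_kernel z \<xi> *\<^sub>R h \<xi>) \<le> 2 / (1 - norm z) * \<bar>B\<bar>"
    using h AE_circle_borel_sphere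
  proof eventually_elim
    case (elim \<xi>)
    then show ?case
      using poisson_kernel_le[OF z, of \<xi>] poisson_kernel_nonneg[OF z, of \<xi>] z
      unfolding norm_scaleR by (intro mult_mono) auto
  qed
qed simp

lemma has_boundary_values_power:
  assumes "has_boundary_values g h"
  shows "has_boundary_values (\<lambda>w. g w ^ n) (\<lambda>\<xi>. h \<xi> ^ n)"
proof -
  obtain B where B: "\<And>w. w \<in> ball 0 1 \<Longrightarrow> norm (g w) \<le> B"
    using assms unfolding has_boundary_values_def bounded_iff by blast
  have [measurable]: "h \<in> borel_measurable borel"
    using assms unfolding has_boundary_values_def by auto
  have "norm (g w ^ n) \<le> B ^ n" if "w \<in> ball 0 1" for w
    unfolding norm_power by (intro power_mono B that) auto
  then have "bounded ((\<lambda>w. g w ^ n) ` ball 0 1)"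
    unfolding bounded_iff by blast
  moreover have "AE \<xi> in circle_borel. (\<lambda>k. g (of_real (radius k) * \<xi>) ^ n) \<longlonglongrightarrow> h \<xi> ^ n"
    using assms unfolding has_boundary_values_def by (auto elim!: eventually_mono intro: tendsto_power)
  ultimately show ?thesis
    using assms unfolding has_boundary_values_def by (auto intro: holomorphic_on_power)
qed

text \<open>The zeroth power of this instance gives the total mass of the Poisson kernel, and the
  higher powers give the moments on the image side of the distribution formula.\<close>

lemma has_boundary_values_ident: "has_boundary_values (\<lambda>w. w) (\<lambda>\<xi>. \<xi>)"
proof -
  have "(\<lambda>n. complex_of_real (radius n) * \<xi>) \<longlonglongrightarrow> \<xi>" for \<xi>
    using tendsto_mult_right[OF tendsto_of_real[OF radius_tendsto, where 'a=complex], of \<xi>] by simp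
  then show ?thesis
    unfolding has_boundary_values_def by (auto simp: bounded_iff intro!: exI[of _ 1] less_imp_le)
qed

section \<open>The boundary distribution of an inner function\<close>

text \<open>Nonnegative powers suffice: on the circle a negative power is a conjugate, and
  \<open>Re (c / x ^ n) = Re (cnj c * x ^ n)\<close>.\<close>

inductive trig_poly :: "(complex \<Rightarrow> real) \<Rightarrow> bool" where
  monom: "trig_poly (\<lambda>x. Re (c * x ^ n))"
| add: "trig_poly p \<Longrightarrow> trig_poly q \<Longrightarrow> trig_poly (\<lambda>x. p x + q x)"

lemma continuous_on_trig_poly: "trig_poly p \<Longrightarrow> continuous_on A p"
  by (induction rule: trig_poly.induct) (auto intro!: continuous_intros)

text \<open>\<open>Re u * Re v\<close> is half of \<open>Re (u * v) + Re (cnj u * v)\<close>. On the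
  circle \<open>cnj (x ^ a) * x ^ b\<close> is again a power once \<open>a \<le> b\<close>, which
  may be assumed by symmetry.\<close>

lemma trig_poly_mult_monom_monom:
  "\<exists>r. trig_poly r \<and> (\<forall>x\<in>sphere 0 1. Re (c * x ^ n) * Re (d * x ^ m) = r x)"
proof (induction n m arbitrary: c d rule: linorder_wlog)
  case (le a b)
  define r where "r x = Re ((c * d / 2) * x ^ (a + b)) + Re ((cnj c * d / 2) * x ^ (b - a))" for x
  have "trig_poly r"
    unfolding r_def by (intro trig_poly.intros)
  moreover have "Re (c * x ^ a) * Re (d * x ^ b) = r x" if x: "x \<in> sphere 0 1" for x
  proof -
    have "cnj (x ^ a) * x ^ b = (cnj x * x) ^ a * x ^ (b - a)"
      using le by (simp add: power_mult_distrib flip: power_add)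
    also have "cnj x * x = 1" using sphere_cnj[OF x] by (simp add: mult.commute)
    finally have eq: "cnj (x ^ a) * x ^ b = x ^ (b - a)" by simp
    have "Re u * Re v = Re (u * v / 2) + Re (cnj u * v / 2)" for u v :: complex
      by (simp add: field_simps)
    from this[of "c * x ^ a" "d * x ^ b"] show ?thesis
      by (simp add: r_def power_add mult_ac flip: eq)
  qed
  ultimately show ?case by blast
next
  case (sym a b)
  from sym[of d c] show ?case
    by (simp only: mult.commute)
qed

lemma trig_poly_mult_monom:
  "trig_poly q \<Longrightarrow> \<exists>r. trig_poly r \<and> (\<forall>x\<in>sphere 0 1. Re (c * x ^ n) * q x = r x)"
proof (induction rule: trig_poly.induct)
  case (monom d m)
  then show ?case by (rule trig_poly_mult_monom_monom)
next
  case (add p q)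
  then obtain r s where "trig_poly r" "\<forall>x\<in>sphere 0 1. Re (c * x ^ n) * p x = r x"
    "trig_poly s" "\<forall>x\<in>sphere 0 1. Re (c * x ^ n) * q x = s x" by blast
  then show ?case
    by (intro exI[of _ "\<lambda>x. r x + s x"]) (auto simp: distrib_left intro: trig_poly.add)
qed

lemma trig_poly_mult:
  "trig_poly p \<Longrightarrow> trig_poly q \<Longrightarrow> \<exists>r. trig_poly r \<and> (\<forall>x\<in>sphere 0 1. p x * q x = r x)"
proof (induction rule: trig_poly.induct)
  case (monom d m)
  then show ?case by (rule trig_poly_mult_monom)
next
  case (add p p')
  then obtain r s where "trig_poly r" "\<forall>x\<in>sphere 0 1. p x * q x = r x"
    "trig_poly s" "\<forall>x\<in>sphere 0 1. p' x * q x = s x" by blast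
  then show ?case
    by (intro exI[of _ "\<lambda>x. r x + s x"]) (auto simp: distrib_right intro: trig_poly.add)
qed

lemma trig_poly_dense:
  fixes \<phi> :: "complex \<Rightarrow> real"
  assumes "continuous_on (sphere 0 1) \<phi>" "0 < e"
  obtains p where "trig_poly p" "\<And>x. x \<in> sphere 0 1 \<Longrightarrow> \<bar>\<phi> x - p x\<bar> < e"
proof -
  \<comment> \<open>Agreement is asked only on the circle, since that is where a product of
    trigonometric polynomials was rewritten as another one.\<close>
  let ?P = "\<lambda>g::complex \<Rightarrow> real. \<exists>p. trig_poly p \<and> (\<forall>x\<in>sphere 0 1. g x = p x)"
  have "\<exists>g. ?P g \<and> (\<forall>x\<in>sphere 0 1. \<bar>\<phi> x - g x\<bar> < e)"
  proof (rule Stone_Weierstrass_HOL[where P = ?P])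
    show "?P (\<lambda>x. c)" for c
      using trig_poly.monom[of "of_real c" 0] by auto
    show "continuous_on (sphere 0 1) g" if "?P g" for g
      using that continuous_on_trig_poly by (metis continuous_on_cong)
    show "?P (\<lambda>x. f x + g x)" if "?P f \<and> ?P g" for f g
      using that trig_poly.add by fastforce
    show "?P (\<lambda>x. f x * g x)" if fg: "?P f \<and> ?P g" for f g
    proof -
      obtain p q where "trig_poly p" "trig_poly q" "\<forall>x\<in>sphere 0 1. f x = p x" "\<forall>x\<in>sphere 0 1. g x = q x"
        using fg by blast
      then show ?thesis using trig_poly_mult[of p q] by auto
    qed
    \<comment> \<open>Two points differ in \<open>Re x\<close> or in
      \<open>Im x = Re (-\<i> * x)\<close>, and both are monomials.\<close>
    show "\<exists>f. ?P f \<and> f x \<noteq> f y" if "x \<in> sphere 0 1 \<and> y \<in> sphere 0 1 \<and> x \<noteq> y" for x y :: complex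
    proof (cases "Re x = Re y")
      case True
      then have "Re (-\<i> * x ^ 1) \<noteq> Re (-\<i> * y ^ 1)" using that by (auto simp: complex_eq_iff)
      then show ?thesis
        using trig_poly.monom[of "-\<i>" 1] by (intro exI[of _ "\<lambda>x. Re (-\<i> * x ^ 1)"]) blast
    next
      case False
      then have "Re (1 * x ^ 1) \<noteq> Re (1 * y ^ 1)" by auto
      then show ?thesis
        using trig_poly.monom[of 1 1] by (intro exI[of _ "\<lambda>x. Re (1 * x ^ 1)"]) blast
    qed
  qed (use assms in auto)
  then obtain g p where "trig_poly p" "\<And>x. x \<in> sphere 0 1 \<Longrightarrow> g x = p x" "\<And>x. x \<in> sphere 0 1 \<Longrightarrow> \<bar>\<phi> x - g x\<bar> < e"
    by blast
  then show ?thesis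
    using that[of p] by auto
qed

lemma integral_poisson_kernel:
  assumes "norm z < 1"
  shows "integral\<^sup>L circle_borel (poisson_kernel z) = 1"
proof -
  have "complex_of_real (integral\<^sup>L circle_borel (poisson_kernel z)) = 1"
    using Poisson_boundary_values[OF has_boundary_values_power[OF has_boundary_values_ident, of 0] assms] by simp
  then show ?thesis by (simp only: of_real_eq_1_iff)
qed

lemma integrable_poisson_kernel_comp:
  fixes \<phi> :: "complex \<Rightarrow> real"
  assumes "norm z < 1" and [measurable]: "h \<in> borel_measurable borel"
    and h: "AE \<xi> in circle_borel. h \<xi> \<in> sphere 0 1" and \<phi>: "continuous_on UNIV \<phi>"
  shows "integrable circle_borel (\<lambda>\<xi>. poisson_kernel z \<xi> * \<phi> (h \<xi>))"
proof -
  have [measurable]: "\<phi> \<in> borel_measurable borel"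
    by (rule borel_measurable_continuous_onI[OF \<phi>])
  have "bounded (\<phi> ` sphere 0 1)"
    using continuous_on_subset[OF \<phi>] by (intro compact_imp_bounded compact_continuous_image) auto
  then obtain B where "\<And>x. x \<in> sphere 0 1 \<Longrightarrow> norm (\<phi> x) \<le> B"
    unfolding bounded_iff by blast
  then have "AE \<xi> in circle_borel. norm (\<phi> (h \<xi>)) \<le> B"
    using h by (auto elim: eventually_mono)
  from integrable_poisson_kernel_mult[OF assms(1) _ this] show ?thesis
    by simp
qed

text \<open>For a monomial both sides are \<open>Re (c * g z ^ n)\<close>: the left by Poisson's
  formula for the power of \<open>g\<close> at \<open>z\<close>, the right by that for the power of
  the identity at \<open>g z\<close>.\<close>

lemma boundary_distribution_trig_poly:
  assumes g: "has_boundary_values g h" and h: "AE \<xi> in circle_borel. h \<xi> \<in> sphere 0 1"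
    and z: "norm z < 1" "norm (g z) < 1" and p: "trig_poly p"
  shows "integral\<^sup>L circle_borel (\<lambda>\<xi>. poisson_kernel z \<xi> * p (h \<xi>)) =
         integral\<^sup>L circle_borel (\<lambda>\<xi>. poisson_kernel (g z) \<xi> * p \<xi>)"
  using p
proof (induction rule: trig_poly.induct)
  have [measurable]: "h \<in> borel_measurable borel"
    using g by (simp add: has_boundary_values_def)
  {
    case (monom c n)
    have *: "integral\<^sup>L circle_borel (\<lambda>\<xi>. poisson_kernel w \<xi> * Re (c * k \<xi> ^ n)) = Re (c * q w ^ n)"
      if q: "has_boundary_values q k" "norm w < 1" and k: "AE \<xi> in circle_borel. k \<xi> \<in> sphere 0 1" for w k q
    proof -
      have [measurable]: "k \<in> borel_measurable borel"
        using q by (simp add: has_boundary_values_def)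
      have "AE \<xi> in circle_borel. norm (k \<xi> ^ n) \<le> 1"
        using k by eventually_elim (simp add: norm_power)
      from integrable_poisson_kernel_mult[OF q(2) _ this]
      have int: "integrable circle_borel (\<lambda>\<xi>. c * (of_real (poisson_kernel w \<xi>) * k \<xi> ^ n))"
        by (simp add: scaleR_conv_of_real)
      have "integral\<^sup>L circle_borel (\<lambda>\<xi>. poisson_kernel w \<xi> * Re (c * k \<xi> ^ n)) =
            integral\<^sup>L circle_borel (\<lambda>\<xi>. Re (c * (of_real (poisson_kernel w \<xi>) * k \<xi> ^ n)))"
        by (intro Bochner_Integration.integral_cong) (auto simp: algebra_simps)
      also have "\<dots> = Re (integral\<^sup>L circle_borel (\<lambda>\<xi>. c * (of_real (poisson_kernel w \<xi>) * k \<xi> ^ n)))"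
        by (rule integral_Re[OF int])
      also have "\<dots> = Re (c * q w ^ n)"
        using Poisson_boundary_values[OF has_boundary_values_power[OF q(1), of n] q(2)] by simp
      finally show ?thesis .
    qed
    show ?case
      using *[OF g z(1) h] *[OF has_boundary_values_ident z(2) AE_circle_borel_sphere] by simp
  next
    case (add p q)
    have "integrable circle_borel (\<lambda>\<xi>. poisson_kernel z \<xi> * r (h \<xi>))"
         "integrable circle_borel (\<lambda>\<xi>. poisson_kernel (g z) \<xi> * r \<xi>)" if "trig_poly r" for r
      using integrable_poisson_kernel_comp[OF z(1) _ h continuous_on_trig_poly[OF that]]
        integrable_poisson_kernel_comp[OF z(2) _ AE_circle_borel_sphere continuous_on_trig_poly[OF that]]
      by auto
    then show ?case
      using add by (simp add: distrib_left)
  }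
qed

text \<open>Uniform approximation within \<open>e/2\<close> changes either side by at most
  \<open>e/2\<close>, because the Poisson kernel has mass 1.\<close>

lemma boundary_distribution_continuous:
  fixes \<phi> :: "complex \<Rightarrow> real"
  assumes g: "has_boundary_values g h" and h: "AE \<xi> in circle_borel. h \<xi> \<in> sphere 0 1"
    and z: "norm z < 1" "norm (g z) < 1" and \<phi>: "continuous_on UNIV \<phi>"
  shows "integral\<^sup>L circle_borel (\<lambda>\<xi>. poisson_kernel z \<xi> * \<phi> (h \<xi>)) =
         integral\<^sup>L circle_borel (\<lambda>\<xi>. poisson_kernel (g z) \<xi> * \<phi> \<xi>)" (is "?L = ?R")
proof -
  have h_meas [measurable]: "h \<in> borel_measurable borel"
    using g by (simp add: has_boundary_values_def)
  have approx: "\<bar>integral\<^sup>L circle_borel (\<lambda>\<xi>. poisson_kernel w \<xi> * \<phi> (k \<xi>)) -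
       integral\<^sup>L circle_borel (\<lambda>\<xi>. poisson_kernel w \<xi> * p (k \<xi>))\<bar> \<le> e"
    if w: "norm w < 1" and [measurable]: "k \<in> borel_measurable borel" and k: "AE \<xi> in circle_borel. k \<xi> \<in> sphere 0 1"
      and p: "trig_poly p" "\<And>x. x \<in> sphere 0 1 \<Longrightarrow> \<bar>\<phi> x - p x\<bar> < e" for w k p e
  proof -
    have i1: "integrable circle_borel (\<lambda>\<xi>. poisson_kernel w \<xi> * \<phi> (k \<xi>))"
      by (rule integrable_poisson_kernel_comp[OF w _ k \<phi>]) simp
    have i2: "integrable circle_borel (\<lambda>\<xi>. poisson_kernel w \<xi> * p (k \<xi>))"
      by (rule integrable_poisson_kernel_comp[OF w _ k continuous_on_trig_poly[OF p(1)]]) simp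
    have i3: "integrable circle_borel (\<lambda>\<xi>. poisson_kernel w \<xi> * e)"
      using integrable_poisson_kernel_mult[OF w, of "\<lambda>_. e" "\<bar>e\<bar>"] by simp
    have "\<bar>integral\<^sup>L circle_borel (\<lambda>\<xi>. poisson_kernel w \<xi> * \<phi> (k \<xi>) - poisson_kernel w \<xi> * p (k \<xi>))\<bar>
        \<le> integral\<^sup>L circle_borel (\<lambda>\<xi>. \<bar>poisson_kernel w \<xi> * \<phi> (k \<xi>) - poisson_kernel w \<xi> * p (k \<xi>)\<bar>)"
      by (rule integral_abs_bound)
    also have "\<dots> \<le> integral\<^sup>L circle_borel (\<lambda>\<xi>. poisson_kernel w \<xi> * e)"
    proof (rule integral_mono_AE)
      show "AE \<xi> in circle_borel. \<bar>poisson_kernel w \<xi> * \<phi> (k \<xi>) - poisson_kernel w \<xi> * p (k \<xi>)\<bar> \<le> poisson_kernel w \<xi> * e"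
        using k
      proof eventually_elim
        case (elim \<xi>)
        have "poisson_kernel w \<xi> * \<bar>\<phi> (k \<xi>) - p (k \<xi>)\<bar> \<le> poisson_kernel w \<xi> * e"
          using p(2)[OF elim] poisson_kernel_nonneg[OF w, of \<xi>] by (intro mult_left_mono) auto
        then show ?case
          using poisson_kernel_nonneg[OF w, of \<xi>] by (simp add: abs_mult flip: right_diff_distrib)
      qed
    qed (use i1 i2 i3 in auto)
    also have "\<dots> = e"
      using integral_poisson_kernel[OF w] by simp
    finally show ?thesis
      using i1 i2 by simp
  qed
  have "\<bar>?L - ?R\<bar> \<le> e" if e: "0 < e" for e
  proof -
    obtain p where p: "trig_poly p" "\<And>x. x \<in> sphere 0 1 \<Longrightarrow> \<bar>\<phi> x - p x\<bar> < e/2"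
      using trig_poly_dense[of \<phi> "e/2"] continuous_on_subset[OF \<phi>] e by auto
    have id: "(\<lambda>\<xi>::complex. \<xi>) \<in> borel_measurable borel"
      by simp
    show ?thesis
      using approx[OF z(1) h_meas h p] approx[OF z(2) id AE_circle_borel_sphere p]
        boundary_distribution_trig_poly[OF g h z p(1)] by linarith
  qed
  then have "\<bar>?L - ?R\<bar> \<le> 0"
    by (rule field_le_epsilon) auto
  then show ?thesis by simp
qed

lemma boundary_distribution_closed:
  assumes g: "has_boundary_values g h" and h: "AE \<xi> in circle_borel. h \<xi> \<in> sphere 0 1"
    and z: "norm z < 1" "norm (g z) < 1" and K: "closed K"
  shows "integral\<^sup>L circle_borel (\<lambda>\<xi>. poisson_kernel z \<xi> * indicator K (h \<xi>)) =
         integral\<^sup>L circle_borel (\<lambda>\<xi>. poisson_kernel (g z) \<xi> * indicator K \<xi>)"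
proof (cases "K = {}")
  case False
  \<comment> \<open>These continuous cut-offs tend to the indicator of \<open>K\<close>, as the
    distance to a closed set is positive off that set.\<close>
  define \<phi> where "\<phi> n x = max 0 (1 - real n * infdist x K)" for n and x :: complex
  have cont: "continuous_on UNIV (\<phi> n)" for n
    unfolding \<phi>_def by (intro continuous_intros)
  have [measurable]: "\<phi> n \<in> borel_measurable borel" for n
    by (rule borel_measurable_continuous_onI[OF cont])
  have [measurable]: "K \<in> sets borel" using K by auto
  have bd: "0 \<le> \<phi> n x" "\<phi> n x \<le> 1" for n x
    using infdist_nonneg[of x K] by (auto simp: \<phi>_def)
  have lim: "(\<lambda>n. \<phi> n x) \<longlonglongrightarrow> indicator K x" for x
  proof (cases "x \<in> K")
    case True
    then show ?thesis by (simp add: \<phi>_def)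
  next
    case xK: False
    then have pos: "infdist x K > 0"
      using infdist_pos_not_in_closed[OF K False] by auto
    obtain N :: nat where N: "real N * infdist x K > 1"
      using reals_Archimedean3[OF pos] by blast
    have "\<phi> n x = 0" if "n \<ge> N" for n
    proof -
      have "real N * infdist x K \<le> real n * infdist x K"
        using that pos by (intro mult_right_mono) auto
      then show ?thesis using N by (simp add: \<phi>_def)
    qed
    then show ?thesis
      using xK by (intro tendsto_eventually) (auto simp: eventually_sequentially)
  qed
  have *: "(\<lambda>n. integral\<^sup>L circle_borel (\<lambda>\<xi>. poisson_kernel w \<xi> * \<phi> n (k \<xi>))) \<longlonglongrightarrow>
       integral\<^sup>L circle_borel (\<lambda>\<xi>. poisson_kernel w \<xi> * indicator K (k \<xi>))"
    if w: "norm w < 1" and [measurable]: "k \<in> borel_measurable borel" for w k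
  proof (rule integral_dominated_convergence[where w = "poisson_kernel w"])
    show "integrable circle_borel (poisson_kernel w)"
      using integrable_poisson_kernel_mult[OF w, of "\<lambda>_. 1::real" 1] by simp
    show "AE \<xi> in circle_borel. norm (poisson_kernel w \<xi> * \<phi> n (k \<xi>)) \<le> poisson_kernel w \<xi>" for n
      using bd poisson_kernel_nonneg[OF w] by (intro AE_I2) (auto simp: abs_mult intro!: mult_left_le)
  qed (use lim in \<open>auto intro!: tendsto_intros\<close>)
  have [measurable]: "h \<in> borel_measurable borel"
    using g by (simp add: has_boundary_values_def)
  have "(\<lambda>n. integral\<^sup>L circle_borel (\<lambda>\<xi>. poisson_kernel z \<xi> * \<phi> n (h \<xi>))) \<longlonglongrightarrow>
       integral\<^sup>L circle_borel (\<lambda>\<xi>. poisson_kernel z \<xi> * indicator K (h \<xi>))"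
    by (rule *[OF z(1)]) simp
  moreover have "(\<lambda>n. integral\<^sup>L circle_borel (\<lambda>\<xi>. poisson_kernel z \<xi> * \<phi> n (h \<xi>))) \<longlonglongrightarrow>
       integral\<^sup>L circle_borel (\<lambda>\<xi>. poisson_kernel (g z) \<xi> * indicator K \<xi>)"
    unfolding boundary_distribution_continuous[OF g h z cont] by (rule *[OF z(2)]) simp
  ultimately show ?thesis by (rule LIMSEQ_unique)
qed simp

text \<open>Two finite measures that agree on closed sets, an intersection-stable generator, agree
  on all Borel sets.\<close>

lemma boundary_distribution:
  assumes g: "has_boundary_values g h" and h: "AE \<xi> in circle_borel. h \<xi> \<in> sphere 0 1"
    and z: "norm z < 1" "norm (g z) < 1" and E: "E \<in> sets borel"
  shows "integral\<^sup>L circle_borel (\<lambda>\<xi>. poisson_kernel z \<xi> * indicator E (h \<xi>)) =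
         integral\<^sup>L circle_borel (\<lambda>\<xi>. poisson_kernel (g z) \<xi> * indicator E \<xi>)"
proof -
  have h_meas [measurable]: "h \<in> borel_measurable borel"
    using g by (simp add: has_boundary_values_def)
  define \<mu> where "\<mu> w k = distr (density circle_borel (\<lambda>\<xi>. ennreal (poisson_kernel w \<xi>))) borel k" for w and k :: "complex \<Rightarrow> complex"
  have \<mu>: "emeasure (\<mu> w k) A = ennreal (integral\<^sup>L circle_borel (\<lambda>\<xi>. poisson_kernel w \<xi> * indicator A (k \<xi>)))"
    if w: "norm w < 1" and [measurable]: "k \<in> borel_measurable borel" "A \<in> sets borel" for w k A
  proof -
    have "k -` A \<in> sets borel"
      using measurable_sets_borel[of k borel A] by simp
    then have "emeasure (\<mu> w k) A = (\<integral>\<^sup>+\<xi>. ennreal (poisson_kernel w \<xi>) * indicator (k -` A) \<xi> \<partial>circle_borel)"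
      unfolding \<mu>_def by (subst emeasure_distr) (auto simp: emeasure_density)
    also have "\<dots> = (\<integral>\<^sup>+\<xi>. ennreal (poisson_kernel w \<xi> * indicator A (k \<xi>)) \<partial>circle_borel)"
      by (intro nn_integral_cong) (auto simp: indicator_def)
    also have "\<dots> = ennreal (integral\<^sup>L circle_borel (\<lambda>\<xi>. poisson_kernel w \<xi> * indicator A (k \<xi>)))"
    proof (rule nn_integral_eq_integral)
      show "integrable circle_borel (\<lambda>\<xi>. poisson_kernel w \<xi> * indicator A (k \<xi>))"
        using integrable_poisson_kernel_mult[OF w, of "\<lambda>\<xi>. indicator A (k \<xi>) :: real" 1]
        by (simp add: indicator_def)
    qed (auto simp: poisson_kernel_nonneg w)
    finally show ?thesis .
  qed
  have "\<mu> z h = \<mu> (g z) (\<lambda>\<xi>. \<xi>)"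
  proof (rule measure_eqI_generator_eq[where E = "Collect closed" and \<Omega> = UNIV and A = "\<lambda>_. UNIV"])
    show "Int_stable (Collect closed :: complex set set)"
      by (auto simp: Int_stable_def)
    show "emeasure (\<mu> z h) X = emeasure (\<mu> (g z) (\<lambda>\<xi>. \<xi>)) X" if "X \<in> Collect closed" for X
      using that boundary_distribution_closed[OF g h z, of X] \<mu>[OF z(1) h_meas, of X] \<mu>[OF z(2), of "\<lambda>\<xi>. \<xi>" X] by auto
    show "sets (\<mu> z h) = sigma_sets UNIV (Collect closed)" "sets (\<mu> (g z) (\<lambda>\<xi>. \<xi>)) = sigma_sets UNIV (Collect closed)"
      by (auto simp: \<mu>_def borel_eq_closed)
    show "emeasure (\<mu> z h) UNIV \<noteq> \<infinity>"
      by (subst \<mu>[OF z(1)]) auto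
  qed auto
  then have "ennreal (integral\<^sup>L circle_borel (\<lambda>\<xi>. poisson_kernel z \<xi> * indicator E (h \<xi>))) =
         ennreal (integral\<^sup>L circle_borel (\<lambda>\<xi>. poisson_kernel (g z) \<xi> * indicator E \<xi>))"
    using \<mu>[OF z(1) h_meas E] \<mu>[OF z(2) _ E, of "\<lambda>\<xi>. \<xi>"] by simp
  then show ?thesis
    by (subst (asm) ennreal_inj) (auto intro!: integral_nonneg_AE simp: poisson_kernel_nonneg z)
qed

section \<open>Boundary values of an inner function and the preimage of a measurable set\<close>

definition boundary_fun :: "(complex \<Rightarrow> complex) \<Rightarrow> complex \<Rightarrow> complex" where
  "boundary_fun f \<xi> = lim (\<lambda>n. if of_real (radius n) * \<xi> \<in> ball 0 1 then f (of_real (radius n) * \<xi>) else 0)"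

lemma has_radial_limit_radius:
  assumes "has_radial_limit f \<xi> L"
  shows "(\<lambda>n. f (of_real (radius n) * \<xi>)) \<longlonglongrightarrow> L"
  using filterlim_compose[OF assms[unfolded has_radial_limit_def] radius_at_left] .

lemma boundary_fun_eq:
  assumes "has_radial_limit f \<xi> L" "\<xi> \<in> sphere 0 1"
  shows "boundary_fun f \<xi> = L"
proof -
  have "of_real (radius n) * \<xi> \<in> ball 0 1" for n
    using assms(2) radius_bounds[of n] by (simp add: norm_mult)
  then show ?thesis
    unfolding boundary_fun_def using has_radial_limit_radius[OF assms(1)] by (simp add: limI)
qed

lemma AE_inner_boundary_fun:
  assumes "inner_function f"
  shows "AE \<xi> in circle_borel. \<xi> \<in> sphere 0 1 \<and> boundary_fun f \<xi> \<in> sphere 0 1 \<and> has_radial_limit f \<xi> (boundary_fun f \<xi>)"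
proof -
  have "AE \<xi> in circle_borel. \<xi> \<in> sphere 0 1 \<longrightarrow> (\<exists>L. has_radial_limit f \<xi> L \<and> norm L = 1)"
    using assms unfolding inner_function_def circle_measure_eq_completion AE_completion_iff by blast
  then show ?thesis
    using AE_circle_borel_sphere
  proof eventually_elim
    case (elim \<xi>)
    then obtain L where L: "has_radial_limit f \<xi> L" "norm L = 1" by blast
    then show ?case using boundary_fun_eq[OF L(1) elim(2)] elim(2) by simp
  qed
qed

text \<open>The cut-off built into \<open>boundary_fun\<close> makes every term of the sequence
  Borel, and then \<open>lim\<close> is Borel whether or not the sequence converges at a given
  point.\<close>

lemma has_boundary_values_inner:
  assumes "inner_function f"
  shows "has_boundary_values f (boundary_fun f)"
  unfolding has_boundary_values_def
proof (intro conjI)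
  show holo: "f holomorphic_on ball 0 1" and "bounded (f ` ball 0 1)"
    using assms by (auto simp: inner_function_def)
  have [measurable]: "(\<lambda>w. if w \<in> ball 0 1 then f w else 0) \<in> borel_measurable borel"
    by (rule borel_measurable_extend_zero[OF holomorphic_on_imp_continuous_on[OF holo]])
  have "(\<lambda>\<xi>. (\<lambda>w. if w \<in> ball 0 1 then f w else 0) (complex_of_real (radius n) * \<xi>)) \<in> borel_measurable borel" for n
    by measurable
  then show "boundary_fun f \<in> borel_measurable borel"
    unfolding boundary_fun_def[abs_def] by (intro borel_measurable_lim_metric) simp
  show "AE \<xi> in circle_borel. (\<lambda>n. f (complex_of_real (radius n) * \<xi>)) \<longlonglongrightarrow> boundary_fun f \<xi>"
    using AE_inner_boundary_fun[OF assms] by eventually_elim (auto intro: has_radial_limit_radius)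
qed

text \<open>Serves to show that \<open>inner_preimage f E\<close> is measurable: it differs only by
  a null set from a Borel preimage under \<open>boundary_fun f\<close>.\<close>

lemma sets_completion_cong_AE:
  assumes "AE x in M. x \<in> A \<longleftrightarrow> x \<in> B" "B \<in> sets M" "A \<subseteq> space M"
  shows "A \<in> sets (completion M)"
proof -
  have "AE x in M. \<not> (x \<in> A \<and> x \<notin> B)" "AE x in M. \<not> (x \<notin> A \<and> x \<in> B)"
    using assms(1) by (auto elim: eventually_mono)
  then have 1: "{x \<in> space M. x \<in> A \<and> x \<notin> B} \<in> sets (completion M)"
    and 2: "{x \<in> space M. x \<notin> A \<and> x \<in> B} \<in> sets (completion M)"
    by (auto dest!: sets_completion_AE simp: pred_def simp del: not_not de_Morgan_conj)
  have eq: "A = (B - {x \<in> space M. x \<notin> A \<and> x \<in> B}) \<union> {x \<in> space M. x \<in> A \<and> x \<notin> B}"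
    using assms(3) sets.sets_into_space[OF assms(2)] by blast
  show ?thesis
    by (subst eq) (intro sets.Un sets.Diff sets_completionI_sets 1 2 assms(2))
qed

text \<open>\<open>E\<close> is a Borel set \<open>S\<close> up to a null set. Preimages of null
  sets are null, so \<open>inner_preimage f E\<close> agrees almost everywhere with the preimage of
  \<open>S\<close>, and \<open>boundary_distribution\<close> applies to \<open>S\<close>.\<close>

lemma
  assumes f: "inner_function f" and self: "f ` ball 0 1 \<subseteq> ball 0 1" and E: "E \<in> sets circle_measure"
  shows inner_preimage_measurable: "inner_preimage f E \<in> sets circle_measure"
    and harm_measure_inner_preimage: "norm z < 1 \<Longrightarrow> harm_measure z (inner_preimage f E) = harm_measure (f z) E"
proof -
  let ?h = "boundary_fun f" and ?T = "inner_preimage f E"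
  note hb = has_boundary_values_inner[OF f]
  have h [measurable]: "?h \<in> borel_measurable borel"
    using hb by (simp add: has_boundary_values_def)
  have h1: "AE \<xi> in circle_borel. ?h \<xi> \<in> sphere 0 1"
    using AE_inner_boundary_fun[OF f] by (auto elim: eventually_mono)
  obtain S N N' where SN: "E = S \<union> N" "N \<subseteq> N'" "N' \<in> null_sets circle_borel" "S \<in> sets circle_borel"
    using E unfolding circle_measure_eq_completion by (rule sets_completionE)
  have [measurable]: "S \<in> sets borel" "N' \<in> sets borel"
    using SN by auto
  have fz: "norm (f z) < 1" if "norm z < 1" for z
    using self that by (simp add: image_subset_iff)
  have N': "AE \<xi> in circle_borel. \<xi> \<notin> N'"
    using SN(3) by (rule AE_not_in)
  \<comment> \<open>The distribution formula at the origin: the integral over the preimage of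
    \<open>N'\<close> vanishes, and the kernel is strictly positive on the circle.\<close>
  have hN: "AE \<xi> in circle_borel. ?h \<xi> \<notin> N'"
  proof -
    have "integral\<^sup>L circle_borel (\<lambda>\<xi>. poisson_kernel 0 \<xi> * indicator N' (?h \<xi>)) =
        integral\<^sup>L circle_borel (\<lambda>\<xi>. poisson_kernel (f 0) \<xi> * indicator N' \<xi>)"
      by (rule boundary_distribution[OF hb h1]) (auto simp: fz)
    also have "\<dots> = 0"
      using N' by (intro integral_eq_zero_AE) (auto elim: eventually_mono)
    finally have "integral\<^sup>L circle_borel (\<lambda>\<xi>. poisson_kernel 0 \<xi> * indicator N' (?h \<xi>)) = 0" .
    moreover have "integrable circle_borel (\<lambda>\<xi>. poisson_kernel 0 \<xi> * indicator N' (?h \<xi>))"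
      using integrable_poisson_kernel_mult[of 0 "\<lambda>\<xi>. indicator N' (?h \<xi>) :: real" 1]
      by (simp add: indicator_def)
    ultimately have "AE \<xi> in circle_borel. poisson_kernel 0 \<xi> * indicator N' (?h \<xi>) = 0"
      by (subst (asm) integral_nonneg_eq_0_iff_AE) (auto simp: poisson_kernel_nonneg)
    then show ?thesis
      using AE_circle_borel_sphere
    proof eventually_elim
      case (elim \<xi>)
      then show ?case using poisson_kernel_pos[of 0 \<xi>] by (auto simp: indicator_def split: if_splits)
    qed
  qed
  have T: "AE \<xi> in circle_borel. \<xi> \<in> ?T \<longleftrightarrow> \<xi> \<in> ?h -` S"
    using AE_inner_boundary_fun[OF f] hN
  proof eventually_elim
    case (elim \<xi>)
    then have "\<xi> \<in> ?T \<longleftrightarrow> ?h \<xi> \<in> E"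
      unfolding inner_preimage_def using boundary_fun_eq[of f \<xi>] by auto
    then show ?case using elim SN by auto
  qed
  have hS: "?h -` S \<in> sets borel"
    using measurable_sets_borel[OF h] by auto
  show meas: "?T \<in> sets circle_measure"
    unfolding circle_measure_eq_completion by (rule sets_completion_cong_AE[OF T]) (use hS in auto)
  assume z: "norm z < 1"
  have harm: "harm_measure w A = integral\<^sup>L circle_borel (\<lambda>\<xi>. poisson_kernel w \<xi> * indicator B \<xi>)"
    if "A \<in> sets circle_measure" and [measurable]: "B \<in> sets borel" and AB: "AE \<xi> in circle_borel. \<xi> \<in> A \<longleftrightarrow> \<xi> \<in> B" for w A B
  proof -
    have pm: "poisson_kernel w \<in> borel_measurable circle_measure"
      unfolding circle_measure_eq_completion by (rule measurable_completion) simp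
    have "harm_measure w A = integral\<^sup>L circle_measure (\<lambda>\<xi>. poisson_kernel w \<xi> * indicator A \<xi>)"
      by (simp add: harm_measure_def set_lebesgue_integral_def poisson_kernel_def mult.commute)
    also have "\<dots> = integral\<^sup>L circle_measure (\<lambda>\<xi>. poisson_kernel w \<xi> * indicator B \<xi>)"
    proof (rule integral_cong_AE)
      have "AE \<xi> in circle_measure. \<xi> \<in> A \<longleftrightarrow> \<xi> \<in> B"
        unfolding circle_measure_eq_completion by (rule AE_completion[OF AB])
      then show "AE \<xi> in circle_measure. poisson_kernel w \<xi> * indicator A \<xi> = poisson_kernel w \<xi> * indicator B \<xi>"
        by eventually_elim (auto simp: indicator_def)
    qed (intro borel_measurable_times pm borel_measurable_indicator that borel_in_sets_circle_measure)+
    also have "\<dots> = integral\<^sup>L circle_borel (\<lambda>\<xi>. poisson_kernel w \<xi> * indicator B \<xi>)"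
      unfolding circle_measure_eq_completion by (rule integral_completion) measurable
    finally show ?thesis .
  qed
  have "harm_measure z ?T = integral\<^sup>L circle_borel (\<lambda>\<xi>. poisson_kernel z \<xi> * indicator S (?h \<xi>))"
    using harm[OF meas hS T, of z] by (simp add: indicator_def)
  also have "\<dots> = integral\<^sup>L circle_borel (\<lambda>\<xi>. poisson_kernel (f z) \<xi> * indicator S \<xi>)"
    by (rule boundary_distribution[OF hb h1 z fz[OF z]]) simp
  also have "\<dots> = harm_measure (f z) E"
    using N' SN by (intro harm[symmetric] E) (auto elim!: eventually_mono)
  finally show "harm_measure z ?T = harm_measure (f z) E" .
qed

section \<open>Hyperbolic derivative and Harnack inequality\<close>

lemma harm_measure_eq: "harm_measure w A = integral\<^sup>L circle_measure (\<lambda>\<xi>. poisson_kernel w \<xi> * indicator A \<xi>)"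
  by (simp add: harm_measure_def set_lebesgue_integral_def poisson_kernel_def mult.commute)

lemma integrable_harm_measure:
  assumes w: "norm w < 1" and A: "A \<in> sets circle_measure"
  shows "integrable circle_measure (\<lambda>\<xi>. poisson_kernel w \<xi> * indicator A \<xi>)"
proof -
  have "integrable circle_borel (poisson_kernel w)"
    using integrable_poisson_kernel_mult[OF w, of "\<lambda>_. 1::real" 1] by simp
  then have "integrable circle_measure (poisson_kernel w)"
    unfolding circle_measure_eq_completion by (subst integrable_completion) auto
  from integrable_mult_indicator[OF A this] show ?thesis
    by (simp add: mult.commute)
qed

lemma harm_measure_nonneg: "norm w < 1 \<Longrightarrow> 0 \<le> harm_measure w A"
  unfolding harm_measure_eq by (intro integral_nonneg_AE AE_I2) (simp add: poisson_kernel_nonneg)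

lemma harm_measure_mono_kernel:
  assumes "norm w < 1" "norm w' < 1" "A \<in> sets circle_measure"
    and le: "\<And>\<xi>. \<xi> \<in> A \<Longrightarrow> \<xi> \<in> sphere 0 1 \<Longrightarrow> c * poisson_kernel w \<xi> \<le> poisson_kernel w' \<xi>"
  shows "c * harm_measure w A \<le> harm_measure w' A"
proof -
  have "integral\<^sup>L circle_measure (\<lambda>\<xi>. c * (poisson_kernel w \<xi> * indicator A \<xi>)) \<le>
        integral\<^sup>L circle_measure (\<lambda>\<xi>. poisson_kernel w' \<xi> * indicator A \<xi>)"
  proof (rule integral_mono_AE)
    show "AE \<xi> in circle_measure. c * (poisson_kernel w \<xi> * indicator A \<xi>) \<le> poisson_kernel w' \<xi> * indicator A \<xi>"
      using AE_circle_measure_sphere by eventually_elim (use le in \<open>auto simp: indicator_def\<close>)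
  qed (use assms integrable_harm_measure in auto)
  then show ?thesis by (simp add: harm_measure_eq)
qed

lemma integrable_indicator_circle_measure:
  fixes c :: real
  assumes "A \<in> sets circle_measure"
  shows "integrable circle_measure (\<lambda>\<xi>. c * indicator A \<xi>)"
  using assms by (intro circle_measure.integrable_const_bound[where B = "\<bar>c\<bar>"]) (auto simp: indicator_def)

lemma harm_measure_le_measure:
  assumes "norm w < 1" "A \<in> sets circle_measure"
    and le: "\<And>\<xi>. \<xi> \<in> A \<Longrightarrow> \<xi> \<in> sphere 0 1 \<Longrightarrow> poisson_kernel w \<xi> \<le> c"
  shows "harm_measure w A \<le> c * measure circle_measure A"
proof -
  have "integral\<^sup>L circle_measure (\<lambda>\<xi>. poisson_kernel w \<xi> * indicator A \<xi>) \<le>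
        integral\<^sup>L circle_measure (\<lambda>\<xi>. c * indicator A \<xi>)"
  proof (rule integral_mono_AE)
    show "AE \<xi> in circle_measure. poisson_kernel w \<xi> * indicator A \<xi> \<le> c * indicator A \<xi>"
      using AE_circle_measure_sphere by eventually_elim (use le in \<open>auto simp: indicator_def\<close>)
  qed (intro integrable_harm_measure integrable_indicator_circle_measure assms)+
  then show ?thesis using assms(2) by (simp add: harm_measure_eq)
qed

lemma harm_measure_ge_measure:
  assumes "norm w < 1" "A \<in> sets circle_measure"
    and le: "\<And>\<xi>. \<xi> \<in> A \<Longrightarrow> \<xi> \<in> sphere 0 1 \<Longrightarrow> c \<le> poisson_kernel w \<xi>"
  shows "c * measure circle_measure A \<le> harm_measure w A"
proof -
  have "integral\<^sup>L circle_measure (\<lambda>\<xi>. c * indicator A \<xi>) \<le>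
        integral\<^sup>L circle_measure (\<lambda>\<xi>. poisson_kernel w \<xi> * indicator A \<xi>)"
  proof (rule integral_mono_AE)
    show "AE \<xi> in circle_measure. c * indicator A \<xi> \<le> poisson_kernel w \<xi> * indicator A \<xi>"
      using AE_circle_measure_sphere by eventually_elim (use le in \<open>auto simp: indicator_def\<close>)
  qed (intro integrable_harm_measure integrable_indicator_circle_measure assms)+
  then show ?thesis using assms(2) by (simp add: harm_measure_eq)
qed

lemma harm_measure_mono:
  assumes "norm w < 1" "A \<in> sets circle_measure" "B \<in> sets circle_measure"
    and sub: "AE \<xi> in circle_measure. \<xi> \<in> A \<longrightarrow> \<xi> \<in> B"
  shows "harm_measure w A \<le> harm_measure w B"
  unfolding harm_measure_eq
proof (rule integral_mono_AE)
  show "AE \<xi> in circle_measure. poisson_kernel w \<xi> * indicator A \<xi> \<le> poisson_kernel w \<xi> * indicator B \<xi>"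
    using sub by eventually_elim (auto simp: indicator_def poisson_kernel_nonneg assms)
qed (use assms integrable_harm_measure in auto)

lemma harm_measure_split:
  assumes "norm w < 1" "A \<in> sets circle_measure" "B \<in> sets circle_measure"
  shows "harm_measure w A = harm_measure w (A \<inter> B) + harm_measure w (A - B)"
proof -
  have "harm_measure w (A \<inter> B) + harm_measure w (A - B) =
    integral\<^sup>L circle_measure (\<lambda>\<xi>. poisson_kernel w \<xi> * indicator (A \<inter> B) \<xi> + poisson_kernel w \<xi> * indicator (A - B) \<xi>)"
    unfolding harm_measure_eq using assms integrable_harm_measure
    by (intro Bochner_Integration.integral_add[symmetric]) auto
  also have "\<dots> = harm_measure w A"
    unfolding harm_measure_eq by (intro Bochner_Integration.integral_cong) (auto simp: indicator_def)
  finally show ?thesis by simp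
qed

text \<open>The vector is half the gradient of \<open>ln (poisson_kernel a \<zeta>)\<close> in
  \<open>a\<close>. Because \<zeta> is unimodular,
  \<open>(\<zeta> - a) \<bullet> a = (N - D) / 2\<close>, and all terms with \<open>D\<close> cancel
  in the squared norm.\<close>

lemma norm_poisson_gradient:
  fixes a \<zeta> :: complex
  assumes a: "norm a < 1" and \<zeta>: "\<zeta> \<in> sphere 0 1"
  shows "norm ((\<zeta> - a) /\<^sub>R (norm (\<zeta> - a))\<^sup>2 - a /\<^sub>R (1 - (norm a)\<^sup>2)) = 1 / (1 - (norm a)\<^sup>2)"
proof -
  define D N where "D = (norm (\<zeta> - a))\<^sup>2" and "N = 1 - (norm a)\<^sup>2"
  have pos: "D > 0" "N > 0"
    using assms norm_lt_1_imp_sq[OF a] by (auto simp: D_def N_def)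
  have D: "(\<zeta> - a) \<bullet> (\<zeta> - a) = D" and aa: "a \<bullet> a = 1 - N"
    by (auto simp: D_def N_def power2_norm_eq_inner)
  have "\<zeta> \<bullet> \<zeta> = 1"
    using \<zeta> by (simp add: dot_square_norm)
  then have "D = 1 - 2 * (\<zeta> \<bullet> a) + a \<bullet> a"
    unfolding D[symmetric] by (simp add: inner_diff_left inner_diff_right inner_commute)
  then have z: "(\<zeta> - a) \<bullet> a = (N - D) / 2"
    by (simp add: inner_diff_left aa)
  have "(norm ((\<zeta> - a) /\<^sub>R D - a /\<^sub>R N))\<^sup>2 = D / D\<^sup>2 - 2 * (((N - D) / 2) / (D * N)) + (1 - N) / N\<^sup>2"
  proof -
    have "(norm (x /\<^sub>R D - a /\<^sub>R N))\<^sup>2 = (x \<bullet> x) / D\<^sup>2 - 2 * ((x \<bullet> a) / (D * N)) + (a \<bullet> a) / N\<^sup>2" for x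
      unfolding power2_norm_eq_inner inner_diff_left inner_diff_right inner_scaleR_left inner_scaleR_right
      using pos by (simp add: inner_commute[of a x] field_simps power2_eq_square)
    then show ?thesis by (simp only: D z aa)
  qed
  also have "\<dots> = (1 / N)\<^sup>2"
    using pos by (simp add: field_simps power2_eq_square)
  finally show ?thesis
    using pos unfolding D_def[symmetric] N_def[symmetric]
    by (metis divide_nonneg_pos norm_ge_zero power2_eq_imp_eq zero_le_one)
qed

text \<open>The logarithmic gradient of the Poisson kernel at \<open>a\<close> has norm \<open>2 / (1 - |a|\<^sup>2)\<close>, so along
  the radius the logarithm of the kernel at \<open>f (x u)\<close> varies at most \<open>q\<close> times as fast as
  the hyperbolic arc length.\<close>

lemma poisson_kernel_radial_mono:
  assumes holo: "f holomorphic_on ball 0 1" and self: "f ` ball 0 1 \<subseteq> ball 0 1"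
    and q: "\<And>z. z \<in> ball 0 1 \<Longrightarrow> hyp_deriv f z \<le> q"
    and u: "u \<in> sphere 0 1" and \<zeta>: "\<zeta> \<in> sphere 0 1" and st: "0 \<le> s" "s \<le> t" "t < 1"
  shows "ln (poisson_kernel (f (s * u)) \<zeta>) + q * (ln (1 + s) - ln (1 - s)) \<le>
         ln (poisson_kernel (f (t * u)) \<zeta>) + q * (ln (1 + t) - ln (1 - t))"
proof (rule DERIV_nonneg_imp_nondecreasing[OF st(2)])
  fix x :: real assume "s \<le> x" "x \<le> t"
  then have x: "0 \<le> x" "x < 1" using st by auto
  have xb: "of_real y * u \<in> ball 0 1" if "0 \<le> y" "y < 1" for y
    using that u by (simp add: norm_mult)
  \<comment> \<open>Negative \<open>y\<close> is included because the derivative at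
    \<open>x = 0\<close> is two-sided.\<close>
  have xb': "of_real y * u \<in> ball 0 1" if "y \<in> {-1<..<1}" for y
    using that u by (auto simp: norm_mult abs_less_iff)
  define a where "a y = f (of_real y * u)" for y :: real
  define a' where "a' = deriv f (of_real x * u) * u"
  have na: "norm (a y) < 1" if "y \<in> {-1<..<1}" for y
    using xb'[OF that] self unfolding a_def by (simp add: image_subset_iff)
  have nax: "norm (a x) < 1" using na x by auto
  have "(f has_field_derivative deriv f (of_real x * u)) (at (of_real x * u))"
    using holomorphic_derivI[OF holo _ xb[OF x]] by auto
  moreover have "((\<lambda>y. of_real y * u) has_vector_derivative u) (at x)"
    unfolding has_vector_derivative_def scaleR_conv_of_real[symmetric] by (auto intro!: derivative_eq_intros)
  ultimately have a_deriv: "(a has_vector_derivative a') (at x)"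
    using field_vector_diff_chain_at[where f = "\<lambda>y. of_real y * u" and x = x and f' = u and g = f
        and g' = "deriv f (of_real x * u)"]
    by (simp add: a_def[abs_def] a'_def o_def mult.commute)
  have d1: "((\<lambda>y. (norm (a y))\<^sup>2) has_real_derivative 2 * (a x \<bullet> a')) (at x)"
    unfolding power2_norm_eq_inner has_real_derivative_iff_has_vector_derivative
    using bounded_bilinear.has_vector_derivative[OF bounded_bilinear_inner a_deriv a_deriv]
    by (simp add: inner_commute)
  have b_deriv: "((\<lambda>y. \<zeta> - a y) has_vector_derivative - a') (at x)"
    using has_vector_derivative_diff[OF has_vector_derivative_const a_deriv] by simp
  have d2: "((\<lambda>y. (norm (\<zeta> - a y))\<^sup>2) has_real_derivative - 2 * ((\<zeta> - a x) \<bullet> a')) (at x)"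
    unfolding power2_norm_eq_inner has_real_derivative_iff_has_vector_derivative
    using bounded_bilinear.has_vector_derivative[OF bounded_bilinear_inner b_deriv b_deriv]
    by (simp add: inner_commute)
  define N D where "N = 1 - (norm (a x))\<^sup>2" and "D = (norm (\<zeta> - a x))\<^sup>2"
  have pos: "N > 0" "D > 0"
    using norm_lt_1_imp_sq[OF nax] \<zeta> nax by (auto simp: N_def D_def)
  have dL: "((\<lambda>y. ln (1 - (norm (a y))\<^sup>2) - ln ((norm (\<zeta> - a y))\<^sup>2) + q * (ln (1 + y) - ln (1 - y)))
      has_real_derivative (- (2 * (a x \<bullet> a')) / N + 2 * ((\<zeta> - a x) \<bullet> a') / D + q * (1/(1+x) + 1/(1-x)))) (at x)"
  proof -
    have "((\<lambda>y. ln (1 - \<alpha> y) - ln (\<beta> y) + q * (ln (1 + y) - ln (1 - y)))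
        has_real_derivative (- \<alpha>' / (1 - \<alpha> x) - \<beta>' / \<beta> x + q * (1/(1+x) + 1/(1-x)))) (at x)"
      if "(\<alpha> has_real_derivative \<alpha>') (at x)" "(\<beta> has_real_derivative \<beta>') (at x)" "0 < 1 - \<alpha> x" "0 < \<beta> x"
      for \<alpha> \<beta> \<alpha>' \<beta>'
      using that x by (auto intro!: derivative_eq_intros)
    from this[OF d1 d2] show ?thesis
      using pos by (simp add: N_def D_def)
  qed
  have "((\<lambda>y. ln (poisson_kernel (f (of_real y * u)) \<zeta>) + q * (ln (1 + y) - ln (1 - y)))
      has_real_derivative (- (2 * (a x \<bullet> a')) / N + 2 * ((\<zeta> - a x) \<bullet> a') / D + q * (1/(1+x) + 1/(1-x)))) (at x)"
  proof (rule has_field_derivative_transform_within_open[OF dL, of "{-1<..<1}"])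
    fix y :: real assume y: "y \<in> {-1<..<1}"
    have "1 - (norm (a y))\<^sup>2 > 0" "(norm (\<zeta> - a y))\<^sup>2 > 0"
      using norm_lt_1_imp_sq[OF na[OF y]] na[OF y] \<zeta> by auto
    then show "ln (1 - (norm (a y))\<^sup>2) - ln ((norm (\<zeta> - a y))\<^sup>2) + q * (ln (1 + y) - ln (1 - y)) =
        ln (poisson_kernel (f (of_real y * u)) \<zeta>) + q * (ln (1 + y) - ln (1 - y))"
      unfolding poisson_kernel_def a_def[symmetric] by (simp add: ln_div)
  qed (use x in auto)
  moreover have "0 \<le> - (2 * (a x \<bullet> a')) / N + 2 * ((\<zeta> - a x) \<bullet> a') / D + q * (1/(1+x) + 1/(1-x))"
  proof -
    \<comment> \<open>Half the logarithmic gradient at \<open>a x\<close>. By Cauchy-Schwarz the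
      logarithm of the kernel changes at rate at most \<open>2 * norm a' / N\<close>, and the bound
      on \<open>hyp_deriv\<close> sets this against \<open>2 * q / (1 - x\<^sup>2)\<close>, the
      derivative of the hyperbolic term.\<close>
    define v where "v = (\<zeta> - a x) /\<^sub>R D - a x /\<^sub>R N"
    have "norm v = 1 / N"
      unfolding v_def D_def N_def by (rule norm_poisson_gradient[OF nax \<zeta>])
    then have "\<bar>v \<bullet> a'\<bar> \<le> 1 / N * norm a'"
      using Cauchy_Schwarz_ineq2[of v a'] by simp
    moreover have "norm a' = norm (deriv f (of_real x * u))"
      using u by (simp add: a'_def norm_mult)
    moreover have "(1 - x\<^sup>2) * norm (deriv f (of_real x * u)) / N \<le> q"
      using q[OF xb[OF x]] u x by (simp add: hyp_deriv_def N_def a_def norm_mult)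
    then have "norm (deriv f (of_real x * u)) / N \<le> q / (1 - x\<^sup>2)"
      using x by (simp add: field_simps abs_square_less_1)
    moreover have "- (2 * (a x \<bullet> a')) / N + 2 * ((\<zeta> - a x) \<bullet> a') / D = 2 * (v \<bullet> a')"
      by (simp add: v_def inner_diff_left divide_inverse algebra_simps)
    moreover have "q * (1/(1+x) + 1/(1-x)) = 2 * (q / (1 - x\<^sup>2))"
    proof -
      have "1/(1+x) + 1/(1-x) = 2 / ((1+x)*(1-x))"
        using x by (simp add: field_simps)
      also have "(1+x)*(1-x) = 1 - x\<^sup>2" by (simp add: power2_eq_square algebra_simps)
      finally show ?thesis by simp
    qed
    ultimately show ?thesis by (simp add: abs_le_iff)
  qed
  ultimately show "\<exists>y. ((\<lambda>y. ln (poisson_kernel (f (of_real y * u)) \<zeta>) + q * (ln (1 + y) - ln (1 - y)))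
      has_real_derivative y) (at x) \<and> 0 \<le> y"
    by blast
qed

text \<open>Compares depths \<open>m\<close> and \<open>e * m\<close> on one radius. The quantity
  \<open>ln (1 + x) - ln (1 - x)\<close> grows by at most \<open>ln (2/e)\<close> between them,
  which becomes the factor \<open>(e/2) powr q\<close> after exponentiation.\<close>

lemma Harnack_radial:
  assumes holo: "f holomorphic_on ball 0 1" and self: "f ` ball 0 1 \<subseteq> ball 0 1"
    and q: "\<And>z. z \<in> ball 0 1 \<Longrightarrow> hyp_deriv f z \<le> q" "0 \<le> q"
    and u: "u \<in> sphere 0 1" and \<zeta>: "\<zeta> \<in> sphere 0 1" and m: "0 < m" "m \<le> 1" and e: "0 < e" "e \<le> 1"
  shows "(e/2) powr q * poisson_kernel (f (of_real (1 - m) * u)) \<zeta> \<le> poisson_kernel (f (of_real (1 - e*m) * u)) \<zeta>"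
proof -
  have em: "0 < e * m" "e * m \<le> m" using m e by (auto intro: mult_left_le_one_le)
  define A B where "A = poisson_kernel (f (of_real (1 - m) * u)) \<zeta>" and "B = poisson_kernel (f (of_real (1 - e*m) * u)) \<zeta>"
  have pos: "0 < poisson_kernel (f (of_real s * u)) \<zeta>" if "0 \<le> s" "s < 1" for s
  proof -
    have "of_real s * u \<in> ball 0 1" using that u by (simp add: norm_mult)
    then show ?thesis using self by (intro poisson_kernel_pos \<zeta>) (simp add: image_subset_iff)
  qed
  have AB: "A > 0" "B > 0"
    using pos[of "1-m"] pos[of "1-e*m"] m em unfolding A_def B_def by auto
  have "ln A + q * (ln (1 + (1-m)) - ln (1 - (1-m))) \<le> ln B + q * (ln (1 + (1-e*m)) - ln (1 - (1-e*m)))"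
    unfolding A_def B_def by (rule poisson_kernel_radial_mono[OF holo self q(1) u \<zeta>]) (use m em in auto)
  then have "ln A - q * (ln (2 - e*m) - ln (2 - m) + ln m - ln (e * m)) \<le> ln B"
    by (simp add: algebra_simps)
  moreover have "ln (2 - e*m) \<le> ln 2" "0 \<le> ln (2 - m)" "ln (e * m) = ln e + ln m"
    using m e em by (auto simp: ln_mult)
  then have "q * (ln (2 - e*m) - ln (2 - m) + ln m - ln (e * m)) \<le> q * (ln 2 - ln e)"
    using q(2) by (intro mult_left_mono) auto
  moreover have "q * ln (e/2) = - (q * (ln 2 - ln e))"
    using e by (simp add: ln_div algebra_simps)
  ultimately have "ln A + q * ln (e/2) \<le> ln B"
    by linarith
  then have "exp (ln A + q * ln (e/2)) \<le> exp (ln B)"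
    by (simp only: exp_le_cancel_iff)
  then have "A * exp (q * ln (e/2)) \<le> B"
    using AB by (simp add: exp_add)
  then show ?thesis
    using e unfolding powr_def A_def B_def by (simp add: mult.commute)
qed

section \<open>Disc automorphisms and the hyperbolic derivative\<close>

definition mobius :: "complex \<Rightarrow> complex \<Rightarrow> complex" where
  "mobius a w = (w - a) / (1 - cnj a * w)"

lemma norm_mobius_denom_sphere:
  assumes "\<xi> \<in> sphere 0 1"
  shows "norm (1 - cnj a * \<xi>) = norm (\<xi> - a)"
proof -
  have "1 - cnj a * \<xi> = \<xi> * cnj (\<xi> - a)"
    using sphere_cnj[OF assms] by (simp add: algebra_simps)
  then show ?thesis using assms by (simp add: norm_mult del: complex_cnj_diff)
qed

lemma norm_mobius_sphere:
  assumes "norm a < 1" "\<xi> \<in> sphere 0 1"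
  shows "norm (mobius a \<xi>) = 1"
proof -
  have "\<xi> \<noteq> a" using assms by auto
  then show ?thesis
    using norm_mobius_denom_sphere[OF assms(2), of a] by (simp add: mobius_def norm_divide)
qed

text \<open>On the circle \<open>1 - cnj a * \<xi>\<close> and \<open>\<xi> - a\<close> have the
  same modulus, which turns the denominators into distances.\<close>

lemma mobius_diff:
  assumes "norm a < 1" "\<xi> \<in> sphere 0 1" "\<eta> \<in> sphere 0 1"
  shows "norm (mobius a \<xi> - mobius a \<eta>) = norm (\<xi> - \<eta>) * (1 - (norm a)\<^sup>2) / (norm (\<xi> - a) * norm (\<eta> - a))"
proof -
  have nz: "1 - cnj a * \<xi> \<noteq> 0" "1 - cnj a * \<eta> \<noteq> 0"
    using assms mobius_denom_nz by auto
  have "mobius a \<xi> - mobius a \<eta> = ((\<xi> - a) * (1 - cnj a * \<eta>) - (\<eta> - a) * (1 - cnj a * \<xi>)) / ((1 - cnj a * \<xi>) * (1 - cnj a * \<eta>))"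
    unfolding mobius_def using nz by (simp add: diff_frac_eq)
  also have "(\<xi> - a) * (1 - cnj a * \<eta>) - (\<eta> - a) * (1 - cnj a * \<xi>) = (\<xi> - \<eta>) * (1 - a * cnj a)"
    by (simp add: algebra_simps)
  also have "1 - a * cnj a = of_real (1 - (norm a)\<^sup>2)"
    by (simp add: complex_norm_square del: of_real_power)
  finally show ?thesis
    using assms norm_lt_1_imp_sq[OF assms(1)] norm_mobius_denom_sphere
    by (simp add: norm_divide norm_mult del: of_real_diff)
qed

lemma has_boundary_values_mobius:
  assumes g: "has_boundary_values g h" and self: "g ` ball 0 1 \<subseteq> ball 0 1"
    and h: "AE \<xi> in circle_borel. h \<xi> \<in> sphere 0 1" and a: "norm a < 1"
  shows "has_boundary_values (\<lambda>w. mobius a (g w)) (\<lambda>\<xi>. mobius a (h \<xi>))"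
  unfolding has_boundary_values_def
proof (intro conjI)
  have holo: "g holomorphic_on ball 0 1" and [measurable]: "h \<in> borel_measurable borel"
    and lim: "AE \<xi> in circle_borel. (\<lambda>n. g (of_real (radius n) * \<xi>)) \<longlonglongrightarrow> h \<xi>"
    using g by (auto simp: has_boundary_values_def)
  have g1: "norm (g w) \<le> 1" if "w \<in> ball 0 1" for w
    using self that by (auto simp: image_subset_iff intro: less_imp_le)
  show "(\<lambda>w. mobius a (g w)) holomorphic_on ball 0 1"
    unfolding mobius_def using mobius_denom_nz[OF a g1] by (intro holomorphic_intros holo) auto
  have "norm (mobius a (g w)) \<le> 2 / (1 - norm a)" if "w \<in> ball 0 1" for w
    unfolding mobius_def norm_divide
    using mobius_denom_ge[OF g1[OF that], of a] g1[OF that] a norm_triangle_ineq4[of "g w" a]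
    by (intro frac_le) auto
  then show "bounded ((\<lambda>w. mobius a (g w)) ` ball 0 1)"
    unfolding bounded_iff by blast
  show "(\<lambda>\<xi>. mobius a (h \<xi>)) \<in> borel_measurable borel"
    unfolding mobius_def by measurable
  show "AE \<xi> in circle_borel. (\<lambda>n. mobius a (g (of_real (radius n) * \<xi>))) \<longlonglongrightarrow> mobius a (h \<xi>)"
    using lim h
  proof eventually_elim
    case (elim \<xi>)
    then show ?case unfolding mobius_def
      using mobius_denom_nz[OF a, of "h \<xi>"] by (intro tendsto_intros) auto
  qed
qed

lemma cmod_diff_unit:
  assumes "norm A = 1" "norm B = 1"
  shows "(norm (A - B))\<^sup>2 = 2 - 2 * Re (A * cnj B)"
proof -
  have "(Re A)\<^sup>2 + (Im A)\<^sup>2 = 1" "(Re B)\<^sup>2 + (Im B)\<^sup>2 = 1"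
    using assms by (simp_all flip: cmod_power2)
  then show ?thesis
    unfolding cmod_power2 by (simp add: power2_diff)
qed

lemma deriv_mobius_comp:
  assumes holo: "g holomorphic_on ball 0 1" and z: "norm z < 1" "norm (g z) < 1"
  shows "deriv (\<lambda>w. mobius (g z) (g w)) z = deriv g z / of_real (1 - (norm (g z))\<^sup>2)"
proof -
  have g': "(g has_field_derivative deriv g z) (at z)"
    using holomorphic_derivI[OF holo, of z] z by auto
  have nz: "1 - cnj (g z) * g z \<noteq> 0"
    using mobius_denom_nz[OF z(2), of "g z"] z by auto
  have eq: "1 - cnj (g z) * g z = of_real (1 - (norm (g z))\<^sup>2)"
    by (simp add: complex_norm_square mult.commute del: of_real_power)
  have "((\<lambda>w. mobius (g z) (g w)) has_field_derivative deriv g z / (1 - cnj (g z) * g z)) (at z)"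
    unfolding mobius_def
    by (rule derivative_eq_intros g' refl nz)+ (use nz in simp)
  then show ?thesis
    unfolding eq by (rule DERIV_imp_deriv)
qed

text \<open>Since \<open>\<integral> G \<cdot> cnj \<phi>\<^sub>z \<cdot> P\<^sub>z\<close> is, up to the factor \<open>1 - |z|\<^sup>2\<close>, the Cauchy
  integral for \<open>G' z\<close> where \<open>G = \<phi>\<^bsub>f z\<^esub> \<circ> f\<close>, it has modulus \<open>D\<^sub>h f z\<close>. Expanding the square
  then measures exactly how far \<open>f\<close> is from a disc automorphism.\<close>

lemma inner_mobius_distance:
  assumes f: "inner_function f" and self: "f ` ball 0 1 \<subseteq> ball 0 1" and z: "norm z < 1"
  obtains \<kappa> where "norm \<kappa> = 1"
    "integral\<^sup>L circle_borel (\<lambda>\<xi>. poisson_kernel z \<xi> *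
        (norm (mobius (f z) (boundary_fun f \<xi>) - \<kappa> * mobius z \<xi>))\<^sup>2) = 2 - 2 * hyp_deriv f z"
proof -
  let ?h = "boundary_fun f"
  note hb = has_boundary_values_inner[OF f]
  have h [measurable]: "?h \<in> borel_measurable borel" and holo: "f holomorphic_on ball 0 1"
    using hb by (auto simp: has_boundary_values_def)
  have h1: "AE \<xi> in circle_borel. ?h \<xi> \<in> sphere 0 1"
    using AE_inner_boundary_fun[OF f] by (auto elim: eventually_mono)
  have fz: "norm (f z) < 1" using self z by (simp add: image_subset_iff)
  note Gb = has_boundary_values_mobius[OF hb self h1 fz]
  have mob_meas [measurable]: "mobius a \<in> borel_measurable borel" for a
    unfolding mobius_def[abs_def] by measurable
  define Q where "Q \<xi> = mobius (f z) (?h \<xi>) * cnj (mobius z \<xi>)" for \<xi>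
  have [measurable]: "cnj \<in> borel_measurable borel"
    by (intro borel_measurable_continuous_onI continuous_intros)
  have Q [measurable]: "Q \<in> borel_measurable borel"
    unfolding Q_def[abs_def] by measurable
  define J where "J = integral\<^sup>L circle_borel (\<lambda>\<xi>. of_real (poisson_kernel z \<xi>) * Q \<xi>)"
  \<comment> \<open>The conjugate of the unimodular \<open>mobius z \<xi>\<close> is its inverse.
    Against the Poisson kernel this produces the Cauchy kernel for the first derivative.\<close>
  have "J = integral\<^sup>L circle_borel (\<lambda>\<xi>. of_real (1 - (norm z)\<^sup>2) * (mobius (f z) (?h \<xi>) * \<xi> / (\<xi> - z) ^ Suc 1))"
    unfolding J_def
  proof (rule integral_cong_AE)
    show "AE \<xi> in circle_borel. of_real (poisson_kernel z \<xi>) * Q \<xi> =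
      of_real (1 - (norm z)\<^sup>2) * (mobius (f z) (?h \<xi>) * \<xi> / (\<xi> - z) ^ Suc 1)"
      using AE_circle_borel_sphere
    proof eventually_elim
      case (elim \<xi>)
      have ne: "\<xi> - z \<noteq> 0" using elim z by auto
      have nz: "1 - cnj z * \<xi> \<noteq> 0"
        using elim z mobius_denom_nz by auto
      have "mobius z \<xi> * cnj (mobius z \<xi>) = 1"
        using norm_mobius_sphere[OF z elim] by (simp flip: complex_norm_square)
      then have "cnj (mobius z \<xi>) = inverse (mobius z \<xi>)"
        by (metis inverse_unique)
      then have cm: "cnj (mobius z \<xi>) = (1 - cnj z * \<xi>) / (\<xi> - z)"
        by (simp add: mobius_def)
      show ?case
        unfolding poisson_kernel_complex[OF elim z] Q_def cm using ne nz
        by (simp add: power2_eq_square)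
    qed
  qed measurable
  also have "\<dots> = of_real (1 - (norm z)\<^sup>2) * deriv (\<lambda>w. mobius (f z) (f w)) z"
    unfolding integral_mult_right_zero using Cauchy_boundary_values[OF Gb z, of 1] by simp
  also have "\<dots> = of_real (1 - (norm z)\<^sup>2) * (deriv f z / of_real (1 - (norm (f z))\<^sup>2))"
    by (simp only: deriv_mobius_comp[OF holo z fz])
  finally have J: "norm J = hyp_deriv f z"
    using norm_lt_1_imp_sq[OF z] norm_lt_1_imp_sq[OF fz]
    by (simp add: norm_mult norm_divide hyp_deriv_def del: of_real_diff)
  \<comment> \<open>The phase of \<open>J\<close>, so that
    \<open>Re (cnj \<kappa> * J) = norm J\<close>. For \<open>J = 0\<close> the sign would be 0,
    hence the separate unimodular value.\<close>
  define \<kappa> where "\<kappa> = (if J = 0 then 1 else sgn J)"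
  have n\<kappa>: "norm \<kappa> = 1" by (simp add: \<kappa>_def norm_sgn)
  have "cnj \<kappa> * J = of_real (norm J)"
  proof (cases "J = 0")
    case False
    have "cnj (sgn J) * J = J * cnj J / of_real (norm J)"
      by (simp add: sgn_eq)
    also have "\<dots> = of_real (norm J)"
      using False by (simp add: power2_eq_square flip: complex_norm_square)
    finally show ?thesis using False by (simp add: \<kappa>_def)
  qed (simp add: \<kappa>_def)
  then have reJ: "Re (cnj \<kappa> * J) = norm J" by simp
  have nQ: "AE \<xi> in circle_borel. norm (Q \<xi>) = 1"
    using h1 AE_circle_borel_sphere
    by eventually_elim (simp add: Q_def norm_mult norm_mobius_sphere fz z)
  then have "AE \<xi> in circle_borel. norm (Q \<xi>) \<le> 1"
    by (auto elim: eventually_mono)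
  from integrable_poisson_kernel_mult[OF z Q this]
  have intQ: "integrable circle_borel (\<lambda>\<xi>. cnj \<kappa> * (of_real (poisson_kernel z \<xi>) * Q \<xi>))"
    by (simp add: scaleR_conv_of_real)
  have intP: "integrable circle_borel (poisson_kernel z)"
    using integrable_poisson_kernel_mult[OF z, of "\<lambda>_. 1::real" 1] by simp
  have "integral\<^sup>L circle_borel (\<lambda>\<xi>. poisson_kernel z \<xi> * (norm (mobius (f z) (?h \<xi>) - \<kappa> * mobius z \<xi>))\<^sup>2) =
    integral\<^sup>L circle_borel (\<lambda>\<xi>. 2 * poisson_kernel z \<xi> - 2 * Re (cnj \<kappa> * (of_real (poisson_kernel z \<xi>) * Q \<xi>)))"
  proof (rule integral_cong_AE)
    show "AE \<xi> in circle_borel. poisson_kernel z \<xi> * (norm (mobius (f z) (?h \<xi>) - \<kappa> * mobius z \<xi>))\<^sup>2 =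
        2 * poisson_kernel z \<xi> - 2 * Re (cnj \<kappa> * (of_real (poisson_kernel z \<xi>) * Q \<xi>))"
      using h1 AE_circle_borel_sphere
    proof eventually_elim
      case (elim \<xi>)
      let ?A = "mobius (f z) (?h \<xi>)" and ?B = "mobius z \<xi>"
      have "norm ?A = 1" "norm (\<kappa> * ?B) = 1"
        using elim by (simp_all add: norm_mobius_sphere fz z norm_mult n\<kappa>)
      then have "(norm (?A - \<kappa> * ?B))\<^sup>2 = 2 - 2 * Re (?A * cnj (\<kappa> * ?B))"
        by (rule cmod_diff_unit)
      also have "?A * cnj (\<kappa> * ?B) = cnj \<kappa> * Q \<xi>"
        by (simp add: Q_def)
      finally have "(norm (?A - \<kappa> * ?B))\<^sup>2 = 2 - 2 * Re (cnj \<kappa> * Q \<xi>)" .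
      moreover have "Re (cnj \<kappa> * (of_real (poisson_kernel z \<xi>) * Q \<xi>)) = poisson_kernel z \<xi> * Re (cnj \<kappa> * Q \<xi>)"
        by (simp add: algebra_simps)
      ultimately show ?case by (simp only: right_diff_distrib mult_ac)
    qed
  qed measurable
  also have "\<dots> = 2 * integral\<^sup>L circle_borel (poisson_kernel z) - 2 * Re (integral\<^sup>L circle_borel (\<lambda>\<xi>. cnj \<kappa> * (of_real (poisson_kernel z \<xi>) * Q \<xi>)))"
  proof -
    have "integrable circle_borel (\<lambda>\<xi>. 2 * poisson_kernel z \<xi>)"
      "integrable circle_borel (\<lambda>\<xi>. 2 * Re (cnj \<kappa> * (of_real (poisson_kernel z \<xi>) * Q \<xi>)))"
      using intP integrable_Re[OF intQ] by (intro integrable_mult_right; simp)+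
    note Bochner_Integration.integral_diff[OF this]
    also note integral_mult_right_zero[of circle_borel 2 "poisson_kernel z"]
    also note integral_mult_right_zero[of circle_borel 2 "\<lambda>\<xi>. Re (cnj \<kappa> * (of_real (poisson_kernel z \<xi>) * Q \<xi>))"]
    also note integral_Re[OF intQ]
    finally show ?thesis .
  qed
  also have "\<dots> = 2 - 2 * Re (cnj \<kappa> * J)"
    unfolding J_def by (simp only: integral_poisson_kernel[OF z] integral_mult_right_zero mult_1_right)
  finally show ?thesis
    using that[OF n\<kappa>] reJ J by simp
qed

text \<open>The Schwarz-Pick bound, read off from the nonnegativity of the integral in
  \<open>inner_mobius_distance\<close>.\<close>

lemma hyp_deriv_le_1:
  assumes f: "inner_function f" and self: "f ` ball 0 1 \<subseteq> ball 0 1" and z: "z \<in> ball 0 1"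
  shows "hyp_deriv f z \<le> 1"
proof -
  have z': "norm z < 1" using z by simp
  obtain \<kappa> where "integral\<^sup>L circle_borel (\<lambda>\<xi>. poisson_kernel z \<xi> *
        (norm (mobius (f z) (boundary_fun f \<xi>) - \<kappa> * mobius z \<xi>))\<^sup>2) = 2 - 2 * hyp_deriv f z"
    using inner_mobius_distance[OF f self z'] by blast
  moreover have "0 \<le> integral\<^sup>L circle_borel (\<lambda>\<xi>. poisson_kernel z \<xi> *
        (norm (mobius (f z) (boundary_fun f \<xi>) - \<kappa> * mobius z \<xi>))\<^sup>2)"
    by (intro integral_nonneg_AE AE_I2) (simp add: poisson_kernel_nonneg z')
  ultimately show ?thesis by simp
qed

section \<open>Comparison on arcs\<close>

lemma arc_center_sphere: "arc_center a l \<in> sphere 0 1"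
  by (simp add: arc_center_def)

lemma norm_radial:
  assumes "u \<in> sphere 0 1" "m \<le> 1"
  shows "norm (complex_of_real (1 - m) * u) = 1 - m"
  using assms by (simp add: norm_mult del: of_real_diff)

lemma one_minus_radial_sq: "1 - (1 - m)\<^sup>2 = m * (2 - m :: real)"
  by (simp add: power2_eq_square algebra_simps)

lemma dist_radial_le:
  assumes u: "u \<in> sphere 0 1" and m: "0 < m" "m \<le> 1" and near: "norm (\<xi> - u) \<le> 4 * m"
  shows "norm (\<xi> - complex_of_real (1 - m) * u) \<le> 5 * m"
proof -
  have "norm (u - complex_of_real (1 - m) * u) = norm (complex_of_real m * u)"
    by (simp add: algebra_simps)
  also have "\<dots> = m" using u m by (simp add: norm_mult)
  finally show ?thesis
    using norm_triangle_ineq[of "\<xi> - u" "u - complex_of_real (1 - m) * u"] near by simp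
qed

text \<open>The numerator is \<open>m * (2 - m) \<ge> m\<close> and the distance to the pole at most
  \<open>5 * m\<close>. The radius \<open>4 * m\<close> leaves room for an arc of half-length
  \<open>pi * m\<close>.\<close>

lemma poisson_kernel_ge_near:
  assumes u: "u \<in> sphere 0 1" and m: "0 < m" "m \<le> 1" and \<xi>: "\<xi> \<in> sphere 0 1" and near: "norm (\<xi> - u) \<le> 4 * m"
  shows "1 / (25 * m) \<le> poisson_kernel (complex_of_real (1 - m) * u) \<xi>"
proof -
  let ?z = "complex_of_real (1 - m) * u"
  have nz: "norm ?z = 1 - m" by (rule norm_radial[OF u m(2)])
  have "\<xi> \<noteq> ?z" using nz \<xi> m by auto
  then have pos: "norm (\<xi> - ?z) > 0" by simp
  have "1 / (25 * m) = m / (5 * m)\<^sup>2"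
    using m by (simp add: power2_eq_square)
  also have "\<dots> \<le> m / (norm (\<xi> - ?z))\<^sup>2"
    using pos m dist_radial_le[OF u m near] by (intro divide_left_mono power_mono mult_pos_pos) auto
  also have "\<dots> \<le> poisson_kernel ?z \<xi>"
    unfolding poisson_kernel_def nz one_minus_radial_sq using m by (intro divide_right_mono) auto
  finally show ?thesis .
qed

text \<open>At distance at least \<open>2 * m\<close> from \<open>u\<close> the two poles are
  equally far up to a factor 2, so the numerators decide. The 8 combines the square of this factor
  with \<open>2 - e*m \<le> 2\<close> against \<open>2 - m \<ge> 1\<close>.\<close>

lemma poisson_kernel_le_far:
  assumes u: "u \<in> sphere 0 1" and m: "0 < m" "m \<le> 1" and e: "0 < e" "e \<le> 1"
    and \<xi>: "\<xi> \<in> sphere 0 1" and far: "2 * m \<le> norm (\<xi> - u)"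
  shows "poisson_kernel (complex_of_real (1 - e * m) * u) \<xi> \<le> 8 * e * poisson_kernel (complex_of_real (1 - m) * u) \<xi>"
proof -
  let ?z = "complex_of_real (1 - m) * u" and ?w = "complex_of_real (1 - e * m) * u"
  have em: "0 < e * m" "e * m \<le> m" using m e by (auto intro: mult_left_le_one_le)
  have nz: "norm ?z = 1 - m" by (rule norm_radial[OF u m(2)])
  have nw: "norm ?w = 1 - e * m" using em m by (intro norm_radial[OF u]) linarith
  have "norm (u - ?w) = norm (complex_of_real (e * m) * u)"
    by (simp add: algebra_simps)
  also have "\<dots> = e * m" using u em by (simp add: norm_mult del: of_real_mult)
  finally have "norm (\<xi> - u) \<le> norm (\<xi> - ?w) + e * m"
    using norm_triangle_ineq4[of "\<xi> - ?w" "u - ?w"] by simp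
  then have w: "m \<le> norm (\<xi> - ?w)" using far em by linarith
  have "norm (?w - ?z) = norm (complex_of_real (m - e * m) * u)"
    by (simp add: algebra_simps)
  also have "\<dots> = m - e * m" using u em by (simp add: norm_mult del: of_real_diff of_real_mult)
  finally have zw: "norm (\<xi> - ?z) \<le> 2 * norm (\<xi> - ?w)"
    using norm_triangle_ineq[of "\<xi> - ?w" "?w - ?z"] w em by simp
  have pz: "norm (\<xi> - ?z) > 0" using nz \<xi> m by auto
  have "poisson_kernel ?w \<xi> = e * m * (2 - e * m) / (norm (\<xi> - ?w))\<^sup>2"
    unfolding poisson_kernel_def nw one_minus_radial_sq ..
  also have "\<dots> \<le> e * m * 2 / (norm (\<xi> - ?z) / 2)\<^sup>2"
    using zw pz em m w by (intro frac_le power_mono mult_left_mono) auto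
  also have "\<dots> = 8 * e * (m / (norm (\<xi> - ?z))\<^sup>2)"
    by (simp add: power_divide)
  also have "\<dots> \<le> 8 * e * poisson_kernel ?z \<xi>"
    unfolding poisson_kernel_def nz one_minus_radial_sq using m e
    by (intro mult_left_mono divide_right_mono) auto
  finally show ?thesis .
qed

lemma arc_pointI:
  assumes "0 < l" "l \<le> 2*pi" "m = l / (2*pi)"
  shows "0 < m" "m \<le> 1" "measure circle_measure (arc a l) = m"
    "arc_point a l = complex_of_real (1 - m) * arc_center a l"
    "norm (arc_point a l) < 1"
proof -
  show m: "0 < m" "m \<le> 1" and M: "measure circle_measure (arc a l) = m"
    using assms by (auto simp: measure_arc)
  show A: "arc_point a l = complex_of_real (1 - m) * arc_center a l"
    by (simp only: arc_point_def M)
  show "norm (arc_point a l) < 1"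
    unfolding A using norm_radial[OF arc_center_sphere m(2)] m by simp
qed

text \<open>On the arc the kernel at its point is at least \<open>1 / (25 * m)\<close>, so the
  measure of the preimage in the arc is controlled by its harmonic measure.\<close>

lemma preimage_density_le:
  assumes f: "inner_function f" and self: "f ` ball 0 1 \<subseteq> ball 0 1" and E: "E \<in> sets circle_measure"
    and l: "0 < l" "l \<le> 2*pi"
  shows "measure circle_measure (inner_preimage f E \<inter> arc a l) / measure circle_measure (arc a l)
         \<le> 25 * harm_measure (f (arc_point a l)) E"
proof -
  define m where "m = l / (2*pi)"
  note A = arc_pointI[OF l m_def]
  let ?z = "arc_point a l" and ?T = "inner_preimage f E" and ?I = "arc a l"
  have T: "?T \<in> sets circle_measure" by (rule inner_preimage_measurable[OF f self E])
  have I: "?I \<in> sets circle_measure" by (intro borel_in_sets_circle_measure arc_borel)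
  have "1 / (25 * m) * measure circle_measure (?T \<inter> ?I) \<le> harm_measure ?z (?T \<inter> ?I)"
  proof (rule harm_measure_ge_measure[OF A(5)])
    fix \<xi> assume \<xi>: "\<xi> \<in> ?T \<inter> ?I" "\<xi> \<in> sphere 0 1"
    have "norm (\<xi> - arc_center a l) \<le> l/2" using dist_arc_center_le \<xi> by auto
    also have "\<dots> = pi * m" by (simp add: m_def)
    also have "\<dots> \<le> 4 * m" using A(1) pi_less_4 by (intro mult_right_mono) auto
    finally show "1 / (25 * m) \<le> poisson_kernel ?z \<xi>"
      unfolding A(4) by (rule poisson_kernel_ge_near[OF arc_center_sphere A(1,2) \<xi>(2)])
  qed (use T I in auto)
  also have "\<dots> \<le> harm_measure ?z ?T"
    by (rule harm_measure_mono[OF A(5)]) (use T I in auto)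
  also have "\<dots> = harm_measure (f ?z) E"
    by (rule harm_measure_inner_preimage[OF f self E A(5)])
  finally show ?thesis
    unfolding A(3) using A(1) by (simp add: field_simps)
qed

text \<open>At depth \<open>e * m\<close> the harmonic measure of the preimage keeps the factor
  \<open>(e/2) powr q\<close>, while its part off the arc supplies at most \<open>8 * e\<close>. The
  rest comes from the arc, where the kernel is at most \<open>2 / (e * m)\<close>. The bound has
  content once the bracket is positive.\<close>

lemma preimage_density_ge:
  assumes f: "inner_function f" and self: "f ` ball 0 1 \<subseteq> ball 0 1" and E: "E \<in> sets circle_measure"
    and q: "\<And>z. z \<in> ball 0 1 \<Longrightarrow> hyp_deriv f z \<le> q" "0 \<le> q"
    and e: "0 < e" "e \<le> 1" and l: "0 < l" "l \<le> 2*pi"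
  shows "e / 2 * ((e/2) powr q - 8 * e) * harm_measure (f (arc_point a l)) E \<le>
    measure circle_measure (inner_preimage f E \<inter> arc a l) / measure circle_measure (arc a l)"
proof -
  define m where "m = l / (2*pi)"
  note A = arc_pointI[OF l m_def]
  define u where "u = arc_center a l"
  have u: "u \<in> sphere 0 1" unfolding u_def by (rule arc_center_sphere)
  let ?z = "complex_of_real (1 - m) * u" and ?w = "complex_of_real (1 - e * m) * u"
  let ?T = "inner_preimage f E" and ?I = "arc a l"
  have holo: "f holomorphic_on ball 0 1" using f by (simp add: inner_function_def)
  have em: "0 < e * m" "e * m \<le> m" using A(1) e by (auto intro: mult_left_le_one_le)
  have nw: "norm ?w = 1 - e * m" using em A(2) by (intro norm_radial[OF u]) linarith
  have z: "norm ?z < 1" using A(5) unfolding A(4) u_def .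
  have w: "norm ?w < 1" using nw em by simp
  have fz: "norm (f ?z) < 1" "norm (f ?w) < 1" using self z w by (auto simp: image_subset_iff simp del: of_real_diff)
  have T: "?T \<in> sets circle_measure" by (rule inner_preimage_measurable[OF f self E])
  have I: "?I \<in> sets circle_measure" by (intro borel_in_sets_circle_measure arc_borel)
  have TI: "?T \<inter> ?I \<in> sets circle_measure" "?T - ?I \<in> sets circle_measure" using T I by auto
  have "(e/2) powr q * harm_measure (f ?z) E \<le> harm_measure (f ?w) E"
    by (rule harm_measure_mono_kernel[OF fz E], rule Harnack_radial[OF holo self q u _ A(1,2) e])
  also have "\<dots> = harm_measure ?w ?T"
    by (rule harm_measure_inner_preimage[OF f self E w, symmetric])
  also have "\<dots> = harm_measure ?w (?T \<inter> ?I) + harm_measure ?w (?T - ?I)"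
    by (rule harm_measure_split[OF w T I])
  also have "harm_measure ?w (?T - ?I) \<le> 8 * e * harm_measure ?z (?T - ?I)"
  proof -
    have "1 / (8 * e) * harm_measure ?w (?T - ?I) \<le> harm_measure ?z (?T - ?I)"
    proof (rule harm_measure_mono_kernel[OF w z TI(2)])
      fix \<xi> assume \<xi>: "\<xi> \<in> ?T - ?I" "\<xi> \<in> sphere 0 1"
      have "2 * m = l / pi" by (simp add: m_def)
      also have "\<dots> \<le> norm (\<xi> - u)"
        unfolding u_def using dist_arc_center_ge[OF \<xi>(2)] \<xi>(1) by auto
      finally have "poisson_kernel ?w \<xi> \<le> 8 * e * poisson_kernel ?z \<xi>"
        by (rule poisson_kernel_le_far[OF u A(1,2) e \<xi>(2)])
      then show "1 / (8 * e) * poisson_kernel ?w \<xi> \<le> poisson_kernel ?z \<xi>"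
        using e by (simp add: field_simps del: of_real_diff of_real_mult)
    qed
    then show ?thesis using e by (simp add: field_simps del: of_real_diff of_real_mult)
  qed
  also have "harm_measure ?z (?T - ?I) \<le> harm_measure ?z ?T"
    by (rule harm_measure_mono[OF z TI(2) T]) auto
  also have "\<dots> = harm_measure (f ?z) E"
    by (rule harm_measure_inner_preimage[OF f self E z])
  also have "harm_measure ?w (?T \<inter> ?I) \<le> 2 / (e * m) * measure circle_measure (?T \<inter> ?I)"
    using poisson_kernel_le[OF w] unfolding nw by (intro harm_measure_le_measure[OF w TI(1)]) auto
  finally have "(e/2) powr q * harm_measure (f ?z) E \<le>
      2 / (e * m) * measure circle_measure (?T \<inter> ?I) + 8 * e * harm_measure (f ?z) E"
    using e by simp
  then have "((e/2) powr q - 8 * e) * harm_measure (f ?z) E \<le> 2 / (e * m) * measure circle_measure (?T \<inter> ?I)"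
    by (simp add: left_diff_distrib del: of_real_diff)
  then have "e / 2 * (((e/2) powr q - 8 * e) * harm_measure (f ?z) E) \<le> e / 2 * (2 / (e * m) * measure circle_measure (?T \<inter> ?I))"
    using e by (intro mult_left_mono) auto
  also have "\<dots> = measure circle_measure (?T \<inter> ?I) / m"
    using e by simp
  finally show ?thesis
    unfolding A(3) A(4) u_def by (simp add: mult.assoc del: of_real_diff)
qed

lemma contractive_imp_comparable:
  assumes f: "inner_function f" and self: "f ` ball 0 1 \<subseteq> ball 0 1"
    and q: "\<And>z. z \<in> ball 0 1 \<Longrightarrow> hyp_deriv f z \<le> q" "0 \<le> q" "q < 1"
  shows "\<exists>C>0. \<forall>E a l. E \<in> sets circle_measure \<longrightarrow> E \<subseteq> sphere 0 1 \<longrightarrow> 0 < l \<longrightarrow> l \<le> 2*pi \<longrightarrow>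
       harm_measure (f (arc_point a l)) E / C
         \<le> measure circle_measure (inner_preimage f E \<inter> arc a l) / measure circle_measure (arc a l) \<and>
       measure circle_measure (inner_preimage f E \<inter> arc a l) / measure circle_measure (arc a l)
         \<le> C * harm_measure (f (arc_point a l)) E"
proof -
  \<comment> \<open>\<open>e\<close> solves \<open>(e/2)\<^bsup>q\<^esup> = 16 e\<close>.\<close>
  define d where "d = 32 powr (- 1 / (1 - q))"
  define e where "e = 2 * d"
  have "d \<le> 32 powr (-1)"
    unfolding d_def using q by (intro powr_mono) (auto simp: field_simps)
  then have d: "0 < d" "d \<le> 1/32"
    unfolding d_def by (auto simp: powr_minus_divide)
  have "- 1 / (1 - q) * (q - 1) = 1"
    using q by (simp add: divide_eq_eq)
  then have "d powr (q - 1) = 32"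
    unfolding d_def powr_powr by simp
  then have "d powr q = 32 * d"
    using d powr_add[of d "q - 1" 1] by simp
  \<comment> \<open>The bracket is \<open>32 * d - 16 * d\<close>, half of the Harnack factor. It is
    \<open>q < 1\<close> that lets such a \<open>d\<close> exist.\<close>
  then have key: "e / 2 * ((e/2) powr q - 8 * e) = 16 * d\<^sup>2"
    by (simp add: e_def power2_eq_square)
  have e: "0 < e" "e \<le> 1" using d by (auto simp: e_def)
  \<comment> \<open>25 serves the upper bound, \<open>1 / (16 * d\<^sup>2)\<close> the lower
    one.\<close>
  define C where "C = max 25 (1 / (16 * d\<^sup>2))"
  have C: "C \<ge> 25" "C \<ge> 1 / (16 * d\<^sup>2)" by (auto simp: C_def)
  then have C': "1 / C \<le> 16 * d\<^sup>2"
    using d by (simp add: field_simps)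
  have "harm_measure (f (arc_point a l)) E / C
         \<le> measure circle_measure (inner_preimage f E \<inter> arc a l) / measure circle_measure (arc a l) \<and>
       measure circle_measure (inner_preimage f E \<inter> arc a l) / measure circle_measure (arc a l)
         \<le> C * harm_measure (f (arc_point a l)) E"
    if E: "E \<in> sets circle_measure" and l: "0 < l" "l \<le> 2*pi" for E a l
  proof
    have "norm (arc_point a l) < 1" using arc_pointI(5)[OF l refl] .
    then have fz: "norm (f (arc_point a l)) < 1" using self by (simp add: image_subset_iff)
    have "harm_measure (f (arc_point a l)) E / C \<le> 16 * d\<^sup>2 * harm_measure (f (arc_point a l)) E"
      using mult_right_mono[OF C' harm_measure_nonneg[OF fz, of E]] by simp
    also have "\<dots> \<le> measure circle_measure (inner_preimage f E \<inter> arc a l) / measure circle_measure (arc a l)"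
      using preimage_density_ge[OF f self E q(1,2) e l] unfolding key .
    finally show "harm_measure (f (arc_point a l)) E / C
         \<le> measure circle_measure (inner_preimage f E \<inter> arc a l) / measure circle_measure (arc a l)" .
    have "25 * harm_measure (f (arc_point a l)) E \<le> C * harm_measure (f (arc_point a l)) E"
      using C harm_measure_nonneg[OF fz, of E] by (intro mult_right_mono) auto
    then show "measure circle_measure (inner_preimage f E \<inter> arc a l) / measure circle_measure (arc a l)
         \<le> C * harm_measure (f (arc_point a l)) E"
      using preimage_density_le[OF f self E l, of a] by linarith
  qed
  moreover have "C > 0" using C by linarith
  ultimately show ?thesis by blast
qed

section \<open>From the comparison on arcs to contractivity\<close>

lemma harm_measure_Markov:
  assumes f: "inner_function f" and z: "norm z < 1" "norm (f z) < 1" and k: "norm \<kappa> = 1" and \<eta>: "0 < \<eta>"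
  defines "g \<equiv> \<lambda>\<xi>. norm (mobius (f z) (boundary_fun f \<xi>) - \<kappa> * mobius z \<xi>)"
  shows "{\<xi>. \<eta> \<le> g \<xi>} \<in> sets borel"
    "harm_measure z {\<xi>. \<eta> \<le> g \<xi>} \<le> integral\<^sup>L circle_borel (\<lambda>\<xi>. poisson_kernel z \<xi> * (g \<xi>)\<^sup>2) / \<eta>\<^sup>2"
proof -
  have [measurable]: "boundary_fun f \<in> borel_measurable borel"
    using has_boundary_values_inner[OF f] by (simp add: has_boundary_values_def)
  have [measurable]: "mobius a \<in> borel_measurable borel" for a
    unfolding mobius_def[abs_def] by measurable
  have g [measurable]: "g \<in> borel_measurable borel"
    unfolding g_def by measurable
  show X [measurable]: "{\<xi>. \<eta> \<le> g \<xi>} \<in> sets borel"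
    by measurable
  have "AE \<xi> in circle_borel. norm ((g \<xi>)\<^sup>2) \<le> 4"
    using AE_inner_boundary_fun[OF f]
  proof eventually_elim
    case (elim \<xi>)
    have "g \<xi> \<le> norm (mobius (f z) (boundary_fun f \<xi>)) + norm (\<kappa> * mobius z \<xi>)"
      unfolding g_def by (rule norm_triangle_ineq4)
    also have "\<dots> = 2"
      using elim by (simp add: norm_mult k norm_mobius_sphere z)
    finally have "(g \<xi>)\<^sup>2 \<le> 2\<^sup>2"
      by (intro power_mono) (auto simp: g_def)
    then show ?case by simp
  qed
  from integrable_poisson_kernel_mult[OF z(1) _ this]
  have int: "integrable circle_borel (\<lambda>\<xi>. poisson_kernel z \<xi> * (g \<xi>)\<^sup>2)"
    by simp
  have "harm_measure z {\<xi>. \<eta> \<le> g \<xi>} = integral\<^sup>L circle_borel (\<lambda>\<xi>. poisson_kernel z \<xi> * indicator {\<xi>. \<eta> \<le> g \<xi>} \<xi>)"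
    unfolding harm_measure_eq circle_measure_eq_completion by (rule integral_completion) measurable
  also have "\<dots> \<le> integral\<^sup>L circle_borel (\<lambda>\<xi>. poisson_kernel z \<xi> * (g \<xi>)\<^sup>2 / \<eta>\<^sup>2)"
  proof (rule integral_mono)
    show "integrable circle_borel (\<lambda>\<xi>. poisson_kernel z \<xi> * indicator {\<xi>. \<eta> \<le> g \<xi>} \<xi>)"
      using integrable_poisson_kernel_mult[OF z(1), of "\<lambda>\<xi>. indicator {\<xi>. \<eta> \<le> g \<xi>} \<xi> :: real" 1]
      by (simp add: indicator_def)
    show "poisson_kernel z \<xi> * indicator {\<xi>. \<eta> \<le> g \<xi>} \<xi> \<le> poisson_kernel z \<xi> * (g \<xi>)\<^sup>2 / \<eta>\<^sup>2" for \<xi>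
    proof -
      have "indicator {\<xi>. \<eta> \<le> g \<xi>} \<xi> \<le> (g \<xi>)\<^sup>2 / \<eta>\<^sup>2"
        using \<eta> by (auto simp: indicator_def intro: power_mono)
      from mult_left_mono[OF this poisson_kernel_nonneg[OF z(1), of \<xi>]] show ?thesis by simp
    qed
  qed (use int in simp)
  finally show "harm_measure z {\<xi>. \<eta> \<le> g \<xi>} \<le> integral\<^sup>L circle_borel (\<lambda>\<xi>. poisson_kernel z \<xi> * (g \<xi>)\<^sup>2) / \<eta>\<^sup>2"
    by simp
qed

lemma continuous_on_mobius_sphere: "norm a < 1 \<Longrightarrow> continuous_on (sphere 0 1) (mobius a)"
  unfolding mobius_def[abs_def] using mobius_denom_nz by (intro continuous_intros) auto

text \<open>The arcs are separated by the angle \<open>pi*m/4\<close> and together span at most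
  \<open>pi\<close>, so chords between them have length at least \<open>m/2\<close>. Both lie within
  \<open>5 * m\<close> of \<open>z\<close>, and \<open>mobius_diff\<close> yields
  \<open>(m/2 * m) / (5*m)\<^sup>2 = 1/50\<close>.\<close>

lemma mobius_separated:
  assumes m: "0 < m" "m \<le> 1" and z: "z = complex_of_real (1 - m) * cis t0"
    and \<xi>: "\<xi> \<in> arc (t0 + pi*m/2) (pi*m/4)" and \<eta>: "\<eta> \<in> arc (t0 - pi*m/4) (pi*m/2)"
  shows "1/50 \<le> norm (mobius z \<xi> - mobius z \<eta>)" "norm (\<xi> - cis t0) \<le> 4 * m" "norm (\<eta> - cis t0) \<le> 4 * m"
proof -
  have u: "cis t0 \<in> sphere 0 1" by simp
  have nz: "norm z = 1 - m" unfolding z by (rule norm_radial[OF u m(2)])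
  obtain t where t: "\<xi> = cis t" "t0 + pi*m/2 \<le> t" "t \<le> t0 + pi*m/2 + pi*m/4"
    using \<xi> by (auto simp: arc_def)
  obtain s where s: "\<eta> = cis s" "t0 - pi*m/4 \<le> s" "s \<le> t0 - pi*m/4 + pi*m/2"
    using \<eta> by (auto simp: arc_def)
  have pm: "0 < pi * m" "pi * m \<le> 4 * m" "pi * m \<le> pi"
    using m pi_less_4 by auto
  have ts: "pi * m / 4 \<le> t - s" "t - s \<le> pi * m" using t s pm by linarith+
  have "m / 2 = 2 * (pi * m / 4) / pi" by simp
  also have "\<dots> \<le> 2 * \<bar>t - s\<bar> / pi"
    using ts pm by (intro divide_right_mono mult_left_mono) auto
  also have "\<dots> \<le> norm (\<xi> - \<eta>)"
  proof -
    have "\<bar>t - s\<bar> \<le> pi" using ts pm by linarith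
    then show ?thesis unfolding t s by (rule norm_cis_diff_ge)
  qed
  finally have far: "m / 2 \<le> norm (\<xi> - \<eta>)" .
  show n: "norm (\<xi> - cis t0) \<le> 4 * m" "norm (\<eta> - cis t0) \<le> 4 * m"
    unfolding t(1) s(1)
    using norm_cis_diff_le[of t t0] norm_cis_diff_le[of s t0] t(2,3) s(2,3) pm by linarith+
  have d: "norm (\<xi> - z) \<le> 5 * m" "norm (\<eta> - z) \<le> 5 * m"
    unfolding z by (rule dist_radial_le[OF u m n(1)], rule dist_radial_le[OF u m n(2)])
  have S: "\<xi> \<in> sphere 0 1" "\<eta> \<in> sphere 0 1" by (auto simp: t s)
  have pos: "0 < norm (\<xi> - z)" "0 < norm (\<eta> - z)" using S nz m by auto
  have "1 / 50 = (m / 2 * m) / ((5 * m) * (5 * m))"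
    using m by simp
  also have "\<dots> \<le> norm (\<xi> - \<eta>) * (1 - (norm z)\<^sup>2) / (norm (\<xi> - z) * norm (\<eta> - z))"
  proof -
    have "m * 1 \<le> m * (2 - m)" using m by (intro mult_left_mono) auto
    then show ?thesis
      unfolding nz one_minus_radial_sq using m d pos far
      by (intro frac_le mult_mono mult_pos_pos mult_nonneg_nonneg; linarith)
  qed
  also have "\<dots> = norm (mobius z \<xi> - mobius z \<eta>)"
    using nz m S by (intro mobius_diff[symmetric]) auto
  finally show "1/50 \<le> norm (mobius z \<xi> - mobius z \<eta>)" .
qed

text \<open>Off a small set \<open>X\<close> the boundary values follow \<kappa> times
  \<open>mobius z\<close>, in the coordinate \<open>mobius (f z)\<close>. The set \<open>E\<close>
  avoids the image of a short arc \<open>I'\<close> but catches that of a nearby arc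
  \<open>J\<close>. So \<open>E\<close> is sizable from \<open>f z\<close>, its preimage meets
  \<open>I'\<close> almost only in \<open>X\<close>, and the lower bound on \<open>I'\<close> keeps
  \<delta> away from 0.\<close>

lemma comparable_imp_hyp_deriv_le:
  assumes f: "inner_function f" and self: "f ` ball 0 1 \<subseteq> ball 0 1" and C: "0 < C"
    and low: "\<And>E a l. E \<in> sets circle_measure \<Longrightarrow> E \<subseteq> sphere 0 1 \<Longrightarrow> 0 < l \<Longrightarrow> l \<le> 2*pi \<Longrightarrow>
       harm_measure (f (arc_point a l)) E / C
         \<le> measure circle_measure (inner_preimage f E \<inter> arc a l) / measure circle_measure (arc a l)"
    and z: "z \<in> ball 0 1"
  shows "hyp_deriv f z \<le> 1 - 1 / (1600 * (2500 + 2000000 * C))"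
proof -
  define \<delta> where "\<delta> = 1 - hyp_deriv f z"
  define m where "m = 1 - norm z"
  \<comment> \<open>For \<open>z = 0\<close> the coefficient \<open>1 - m\<close> vanishes and any
    angle will do.\<close>
  define t0 where "t0 = Arg z"
  have z1: "norm z < 1" using z by simp
  have m: "0 < m" "m \<le> 1" using z1 by (auto simp: m_def)
  have zeq: "z = complex_of_real (1 - m) * cis t0"
    unfolding m_def t0_def using rcis_cmod_Arg[of z] by (simp add: rcis_def)
  have fz: "norm (f z) < 1" using self z by (simp add: image_subset_iff)
  have holo: "f holomorphic_on ball 0 1" using f by (simp add: inner_function_def)
  obtain \<kappa> where \<kappa>: "norm \<kappa> = 1" and dist: "integral\<^sup>L circle_borel (\<lambda>\<xi>. poisson_kernel z \<xi> *
        (norm (mobius (f z) (boundary_fun f \<xi>) - \<kappa> * mobius z \<xi>))\<^sup>2) = 2 - 2 * hyp_deriv f z"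
    using inner_mobius_distance[OF f self z1] by blast
  \<comment> \<open>The threshold is half of the separation \<open>1/50\<close>; Markov's inequality
    turns it into the factor \<open>2 * 100\<^sup>2 = 20000\<close>.\<close>
  define X where "X = {\<xi>. 1/100 \<le> norm (mobius (f z) (boundary_fun f \<xi>) - \<kappa> * mobius z \<xi>)}"
  have X: "X \<in> sets circle_measure"
    unfolding X_def by (intro borel_in_sets_circle_measure harm_measure_Markov[OF f z1 fz \<kappa>]) simp
  have "harm_measure z X \<le> (2 - 2 * hyp_deriv f z) / (1/100)\<^sup>2"
    unfolding X_def dist[symmetric] by (rule harm_measure_Markov[OF f z1 fz \<kappa>]) simp
  then have hX: "harm_measure z X \<le> 20000 * \<delta>"
    by (simp add: \<delta>_def power2_eq_square)
  \<comment> \<open>\<open>I'\<close> is centred on the radius of \<open>z\<close> and has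
    normalized length \<open>m/4\<close>, so its point lies on that radius at depth
    \<open>m/4\<close>.\<close>
  define a' l' where "a' = t0 - pi*m/4" and "l' = pi*m/2"
  define I' J where "I' = arc a' l'" and "J = arc (t0 + pi*m/2) (pi*m/4)"
  have pm: "0 < pi * m" "pi * m \<le> pi" using m by auto
  have l': "0 < l'" "l' \<le> 2*pi" using pm by (auto simp: l'_def)
  have "m / 4 = l' / (2*pi)" by (simp add: l'_def)
  note A = arc_pointI[OF l' this]
  have center: "arc_center a' l' = cis t0"
    by (simp add: arc_center_def a'_def l'_def)
  have measJ: "measure circle_measure J = m / 8"
    unfolding J_def by (subst measure_arc) (use pm in auto)
  have I': "I' \<in> sets circle_measure" and J: "J \<in> sets circle_measure"
    unfolding I'_def J_def by (intro borel_in_sets_circle_measure arc_borel)+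
  \<comment> \<open>As an intersection over \<open>I'\<close> of closed conditions, \<open>E\<close>
    is closed and hence measurable.\<close>
  define E where "E = sphere 0 1 \<inter> (\<Inter>\<eta>\<in>I'. sphere 0 1 \<inter> (\<lambda>\<zeta>. norm (mobius (f z) \<zeta> - \<kappa> * mobius z \<eta>)) -` {1/100..})"
  have "closed (sphere 0 1 \<inter> (\<lambda>\<zeta>. norm (mobius (f z) \<zeta> - \<kappa> * mobius z \<eta>)) -` {1/100..})" for \<eta>
    by (intro continuous_closed_preimage continuous_intros continuous_on_mobius_sphere fz) auto
  then have "closed E"
    unfolding E_def by (intro closed_Int closed_INT) auto
  then have E: "E \<in> sets circle_measure"
    by (intro borel_in_sets_circle_measure) auto
  have Es: "E \<subseteq> sphere 0 1" by (auto simp: E_def)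
  have memE: "\<zeta> \<in> E \<longleftrightarrow> \<zeta> \<in> sphere 0 1 \<and> (\<forall>\<eta>\<in>I'. 1/100 \<le> norm (mobius (f z) \<zeta> - \<kappa> * mobius z \<eta>))" for \<zeta>
    unfolding E_def by auto
  define T where "T = inner_preimage f E"
  have T: "T \<in> sets circle_measure" unfolding T_def by (rule inner_preimage_measurable[OF f self E])
  have bd: "AE \<xi> in circle_measure. \<xi> \<in> sphere 0 1 \<and> boundary_fun f \<xi> \<in> sphere 0 1 \<and> has_radial_limit f \<xi> (boundary_fun f \<xi>)"
    unfolding circle_measure_eq_completion by (rule AE_completion[OF AE_inner_boundary_fun[OF f]])
  \<comment> \<open>A point of \<open>I'\<close> with boundary value in \<open>E\<close> is itself
    one of the \<eta> to be avoided, so it lies in \<open>X\<close>.\<close>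
  have "AE \<xi> in circle_measure. \<xi> \<in> T \<inter> I' \<longrightarrow> \<xi> \<in> X"
    using bd
  proof eventually_elim
    case (elim \<xi>)
    show ?case
    proof
      assume \<xi>: "\<xi> \<in> T \<inter> I'"
      then have "boundary_fun f \<xi> \<in> E"
        unfolding T_def inner_preimage_def using boundary_fun_eq by auto
      then show "\<xi> \<in> X" using \<xi> unfolding memE X_def by auto
    qed
  qed
  then have hTI: "harm_measure z (T \<inter> I') \<le> 20000 * \<delta>"
    using harm_measure_mono[OF z1 _ X, of "T \<inter> I'"] T I' hX by auto
  \<comment> \<open>Off \<open>X\<close> the boundary value is within \<open>1/100\<close> of the
    image of \<xi>, which is \<open>1/50\<close> away from the image of \<open>I'\<close>; the
    difference \<open>1/100\<close> puts it in \<open>E\<close>.\<close>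
  have "AE \<xi> in circle_measure. \<xi> \<in> J - X \<longrightarrow> \<xi> \<in> T"
    using bd
  proof eventually_elim
    case (elim \<xi>)
    show ?case
    proof
      assume \<xi>: "\<xi> \<in> J - X"
      have "1/100 \<le> norm (mobius (f z) (boundary_fun f \<xi>) - \<kappa> * mobius z \<eta>)" if \<eta>: "\<eta> \<in> I'" for \<eta>
      proof -
        have "1/50 \<le> norm (mobius z \<xi> - mobius z \<eta>)"
          using mobius_separated(1)[OF m zeq] \<xi> \<eta> unfolding J_def I'_def a'_def l'_def by blast
        then have "1/50 \<le> norm (\<kappa> * mobius z \<xi> - \<kappa> * mobius z \<eta>)"
          using \<kappa> by (simp add: norm_mult flip: right_diff_distrib)
        moreover have "norm (mobius (f z) (boundary_fun f \<xi>) - \<kappa> * mobius z \<xi>) < 1/100"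
          using \<xi> by (auto simp: X_def)
        ultimately show ?thesis
          using norm_triangle_ineq4[of "mobius (f z) (boundary_fun f \<xi>) - \<kappa> * mobius z \<eta>" "mobius (f z) (boundary_fun f \<xi>) - \<kappa> * mobius z \<xi>"]
          by simp
      qed
      then have "boundary_fun f \<xi> \<in> E" using elim unfolding memE by blast
      then show "\<xi> \<in> T" unfolding T_def inner_preimage_def using elim by blast
    qed
  qed
  then have "harm_measure z (J - X) \<le> harm_measure z T"
    using J X T by (intro harm_measure_mono[OF z1]) auto
  moreover have "harm_measure z (J \<inter> X) \<le> harm_measure z X"
    using J X by (intro harm_measure_mono[OF z1]) auto
  moreover have "harm_measure z J = harm_measure z (J \<inter> X) + harm_measure z (J - X)"
    by (rule harm_measure_split[OF z1 J X])
  moreover have "1 / (25 * m) * measure circle_measure J \<le> harm_measure z J"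
  proof (rule harm_measure_ge_measure[OF z1 J])
    fix \<xi> assume \<xi>: "\<xi> \<in> J" "\<xi> \<in> sphere 0 1"
    have "cis a' \<in> arc (t0 - pi*m/4) (pi*m/2)"
      unfolding arc_def a'_def using pm by (intro imageI) auto
    then have "norm (\<xi> - cis t0) \<le> 4 * m"
      using mobius_separated(2)[OF m zeq] \<xi>(1) unfolding J_def by blast
    then show "1 / (25 * m) \<le> poisson_kernel z \<xi>"
      unfolding zeq by (intro poisson_kernel_ge_near[OF _ m \<xi>(2)]) auto
  qed
  then have "1/200 \<le> harm_measure z J"
    unfolding measJ using m by simp
  ultimately have "1/200 - 20000 * \<delta> \<le> harm_measure z T"
    using hX by linarith
  also have "\<dots> = harm_measure (f z) E"
    unfolding T_def by (rule harm_measure_inner_preimage[OF f self E z1])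
  finally have hE: "1/200 - 20000 * \<delta> \<le> harm_measure (f z) E" .
  define w where "w = arc_point a' l'"
  have weq: "w = complex_of_real (1 - 1/4 * m) * cis t0"
    unfolding w_def A(4) center by simp
  have fw: "norm (f w) < 1" using A(5) self by (simp add: image_subset_iff w_def)
  \<comment> \<open>Schwarz-Pick allows the exponent 1 in \<open>Harnack_radial\<close>; with
    \<open>e = 1/4\<close> the factor \<open>e/2\<close> is \<open>1/8\<close>.\<close>
  have hw: "1/8 * harm_measure (f z) E \<le> harm_measure (f w) E"
  proof (rule harm_measure_mono_kernel[OF fz fw E])
    fix \<zeta> assume \<zeta>: "\<zeta> \<in> E" "\<zeta> \<in> sphere 0 1"
    have "(1/4/2) powr 1 * poisson_kernel (f (complex_of_real (1 - m) * cis t0)) \<zeta> \<le> poisson_kernel (f (complex_of_real (1 - 1/4*m) * cis t0)) \<zeta>"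
      using hyp_deriv_le_1[OF f self] by (intro Harnack_radial[OF holo self _ _ _ \<zeta>(2) m]) auto
    then show "1/8 * poisson_kernel (f z) \<zeta> \<le> poisson_kernel (f w) \<zeta>"
      unfolding zeq[symmetric] weq[symmetric] by simp
  qed
  have "1 / (25 * m) * measure circle_measure (T \<inter> I') \<le> harm_measure z (T \<inter> I')"
  proof (rule harm_measure_ge_measure[OF z1])
    fix \<xi> assume \<xi>: "\<xi> \<in> T \<inter> I'" "\<xi> \<in> sphere 0 1"
    have "norm (\<xi> - arc_center a' l') \<le> l'/2"
      using \<xi> unfolding I'_def by (intro dist_arc_center_le) auto
    also have "\<dots> \<le> 4 * m" using m pi_less_4 by (simp add: l'_def)
    finally show "1 / (25 * m) \<le> poisson_kernel z \<xi>"
      unfolding center zeq by (intro poisson_kernel_ge_near[OF _ m \<xi>(2)]) auto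
  qed (use T I' in auto)
  \<comment> \<open>The 100 is 25 from the kernel bound times 4 from the length \<open>m/4\<close>
    of \<open>I'\<close>.\<close>
  moreover have "measure circle_measure (T \<inter> I') / (m/4) = 100 * (1 / (25 * m) * measure circle_measure (T \<inter> I'))"
    by simp
  ultimately have "measure circle_measure (T \<inter> I') / (m/4) \<le> 100 * (20000 * \<delta>)"
    using hTI by linarith
  moreover have "harm_measure (f w) E / C \<le> measure circle_measure (T \<inter> I') / (m/4)"
    using low[OF E Es l', of a'] unfolding A(3) T_def I'_def w_def .
  ultimately have "harm_measure (f w) E / C \<le> 2000000 * \<delta>"
    by linarith
  then have "harm_measure (f w) E \<le> 2000000 * C * \<delta>"
    using C by (simp add: field_simps)
  \<comment> \<open>An eighth of \<open>1/200 - 20000 * \<delta>\<close> is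
    \<open>1/1600 - 2500 * \<delta>\<close>.\<close>
  then have "1/1600 \<le> (2500 + 2000000 * C) * \<delta>"
    using hE hw by (simp add: algebra_simps)
  then have "1 / (1600 * (2500 + 2000000 * C)) \<le> \<delta>"
    using C by (simp add: field_simps)
  then show ?thesis by (simp add: \<delta>_def)
qed

text \<open>The second assumption excludes exactly the unimodular constants among the inner
  functions; for them \<open>1 - (norm (f z))\<^sup>2\<close> vanishes, and so both sides
  degenerate.\<close>

theorem theorem3:
  fixes f :: "complex \<Rightarrow> complex"
  assumes "inner_function f"
    and "f ` ball 0 1 \<subseteq> ball 0 1"
  shows "(SUP z\<in>ball 0 1. hyp_deriv f z) < 1 \<longleftrightarrow>
    (\<exists>C>0. \<forall>E a l. E \<in> sets circle_measure \<longrightarrow> E \<subseteq> sphere 0 1 \<longrightarrow> 0 < l \<longrightarrow> l \<le> 2*pi \<longrightarrow>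
       harm_measure (f (arc_point a l)) E / C
         \<le> measure circle_measure (inner_preimage f E \<inter> arc a l) / measure circle_measure (arc a l) \<and>
       measure circle_measure (inner_preimage f E \<inter> arc a l) / measure circle_measure (arc a l)
         \<le> C * harm_measure (f (arc_point a l)) E)" (is "?L \<longleftrightarrow> (\<exists>C>0. ?Q C)")
proof
  assume L: ?L
  \<comment> \<open>The \<open>max\<close> supplies the nonnegative exponent for
    \<open>Harnack_radial\<close>. The Schwarz-Pick bound on the next lines is what makes the
    supremum dominate every value.\<close>
  define q where "q = max 0 (SUP z\<in>ball 0 1. hyp_deriv f z)"
  have bdd: "bdd_above (hyp_deriv f ` ball 0 1)"
    using hyp_deriv_le_1[OF assms] by (auto intro!: bdd_aboveI[of _ 1])
  have "hyp_deriv f z \<le> q" if "z \<in> ball 0 1" for z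
    using cSUP_upper[OF that bdd] by (simp add: q_def)
  moreover have "0 \<le> q" "q < 1" using L by (auto simp: q_def)
  ultimately show "\<exists>C>0. ?Q C"
    by (rule contractive_imp_comparable[OF assms])
next
  assume "\<exists>C>0. ?Q C"
  then obtain C where C: "0 < C" and Q: "?Q C" by (elim exE conjE)
  have low: "harm_measure (f (arc_point a l)) E / C
         \<le> measure circle_measure (inner_preimage f E \<inter> arc a l) / measure circle_measure (arc a l)"
    if "E \<in> sets circle_measure" "E \<subseteq> sphere 0 1" "0 < l" "l \<le> 2*pi" for E a l
    using Q[rule_format, OF that] by (rule conjunct1)
  have "(SUP z\<in>ball 0 1. hyp_deriv f z) \<le> 1 - 1 / (1600 * (2500 + 2000000 * C))"
    by (rule cSUP_least) (use comparable_imp_hyp_deriv_le[OF assms C low] in auto)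
  also have "\<dots> < 1" using C by simp
  finally show ?L .
qed

end
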